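(* Let $\lambda_1,\lambda_2\in\mathbb{R}$ satisfy $-2<\lambda_i<0$ ($i=1,2$) and $\lambda_1+\lambda_2<-1$, and let $q\in\mathbb{C}$ satisfy $$\max\Big\{\tfrac12(2+\lambda_1+\lambda_2),\ 2+\lambda_1+\lambda_2\Big\}<\Re(q)<\min\{1,\ 2+\lambda_1,\ 2+\lambda_2\}.$$ Then, with $\mathfrak{CM}(q\,|\,\tau,\lambda_1,\lambda_2)$ as defined in the context, $$\begin{aligned}\lim_{\tau\downarrow1}\Bigl[\Gamma(1-1/\tau)^q\,\mathfrak{CM}(q\,|\,\tau,\lambda_1,\lambda_2)\Bigr]=&\ \pi^q\,\Gamma(1-q)\,\frac{G(2+\lambda_1)}{G(2-q+\lambda_1)}\,\frac{G(2+\lambda_2)}{G(2-q+\lambda_2)}\,\frac{G(2)}{G(2-q)}\,\frac{G(4-2q+\lambda_1+\lambda_2)}{G(4-q+\lambda_1+\lambda_2)}\\&\times\frac{G(2)}{G(q+2)}\,\frac{G(-\lambda_1)}{G(q-\lambda_1)}\,\frac{G(-\lambda_2)}{G(q-\lambda_2)}\,\frac{G(2q-2-(\lambda_1+\lambda_2))}{G(q-2-(\lambda_1+\lambda_2))}.\end{aligned}$$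
   Context: $\Gamma$ is Euler's gamma function and $G$ is the classical Barnes $G$-function: the entire function with $G(1)=1$ and $G(z+1)=\Gamma(z)G(z)$, having zeros exactly at $z=-n$ ($n=0,1,2,\dots$) of multiplicity $n+1$. For $\tau>0$, $\Gamma_2(w|\tau)$ denotes the Barnes double gamma function with parameters $(1,\tau)$: for $\Re(w)>0$, $\Gamma_2(w|\tau)=\exp\bigl(\partial_s\zeta_2(s,w)|_{s=0}\bigr)$, where $\zeta_2(s,w)$ is the analytic continuation in $s$ of $\sum_{k_1,k_2=0}^\infty (w+k_1+k_2\tau)^{-s}$ ($\Re(s)>2$). It extends to a meromorphic function of $w\in\mathbb{C}$ without zeros and with poles exactly at $w=-(k_1+k_2\tau)$, $k_1,k_2=0,1,2,\dots$. For $\tau>1$ the function $\mathfrak{CM}$ (the analytic continuation of the complex Selberg integral) is given by $$\begin{aligned}\mathfrak{CM}(q\,|\,\tau,\lambda_1,\lambda_2)=&\Bigl(\frac{\Gamma(1/\tau)\,\pi\,\tau^{1/\tau}}{\Gamma(1-1/\tau)}\Bigr)^q\,\Gamma\bigl(1-\tfrac q\tau\bigr)\,\frac{\Gamma_2(1-q+\tau(1+\lambda_1)|\tau)}{\Gamma_2(1+\tau(1+\lambda_1)|\tau)}\,\frac{\Gamma_2(1-q+\tau(1+\lambda_2)|\tau)}{\Gamma_2(1+\tau(1+\lambda_2)|\tau)}\\&\times\frac{\Gamma_2(1-q+\tau|\tau)}{\Gamma_2(1+\tau|\tau)}\,\frac{\Gamma_2(2-q+\tau(2+\lambda_1+\lambda_2)|\tau)}{\Gamma_2(2-2q+\tau(2+\lambda_1+\lambda_2)|\tau)}\,\frac{\Gamma_2(q+1+\tau|\tau)}{\Gamma_2(1+\tau|\tau)}\\&\times\frac{\Gamma_2(q-\tau\lambda_1|\tau)}{\Gamma_2(-\tau\lambda_1|\tau)}\,\frac{\Gamma_2(q-\tau\lambda_2|\tau)}{\Gamma_2(-\tau\lambda_2|\tau)}\,\frac{\Gamma_2(q-1-\tau(1+\lambda_1+\lambda_2)|\tau)}{\Gamma_2(2q-1-\tau(1+\lambda_1+\lambda_2)|\tau)}.\end{aligned}$$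 Powers $x^q$ with $x>0$ are $e^{q\log x}$ with real $\log x$. *)

theory Defs
  imports "HOL-Complex_Analysis.Complex_Analysis"
begin

(* The functional equation and G(1) = 1 alone do not determine G, so the classical Barnes
   G-function is given by its canonical Weierstrass product
     G(1+z) = (2 pi)^(z/2) exp(-(z + z^2 (1 + gamma)) / 2)
                * prod_{k>=1} (1 + z/k)^k exp(z^2/(2k) - z);
   below, the index k is shifted by one. *)
definition barnes_G :: "complex \<Rightarrow> complex" where
  "barnes_G w = (let z = w - 1 in
     of_real (2 * pi) powr (z / 2) * exp (- (z + z\<^sup>2 * (1 + euler_mascheroni)) / 2) *
     (\<Prod>k. (1 + z / of_nat (Suc k)) ^ Suc k * exp (z\<^sup>2 / (2 * of_nat (Suc k)) - z)))"

(* The analytic continuation in s, for Re w > 0, of the double series; its only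
   singularities are at s = 1 and s = 2, where the value is unspecified. *)
definition barnes_zeta2 :: "real \<Rightarrow> complex \<Rightarrow> complex \<Rightarrow> complex" where
  "barnes_zeta2 \<tau> w = (SOME f. f holomorphic_on (UNIV - {1, 2}) \<and>
     (\<forall>s. Re s > 2 \<longrightarrow>
        f s = (\<Sum>\<^sub>\<infinity>(k1, k2)\<in>(UNIV :: (nat \<times> nat) set).
                 (w + of_nat k1 + of_nat k2 * of_real \<tau>) powr (- s))))"

definition barnes_Gamma2_right :: "complex \<Rightarrow> real \<Rightarrow> complex" where
  "barnes_Gamma2_right w \<tau> = exp (deriv (barnes_zeta2 \<tau> w) 0)"

(* On Re w <= 0 this is the meromorphic continuation, with value 0 at the poles
   (as for the library's Gamma). *)
definition barnes_Gamma2 :: "complex \<Rightarrow> real \<Rightarrow> complex" where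
  "barnes_Gamma2 w \<tau> =
     (if Re w > 0 then barnes_Gamma2_right w \<tau>
      else (THE g. g nicely_meromorphic_on UNIV \<and>
                   (\<forall>z. Re z > 0 \<longrightarrow> g z = barnes_Gamma2_right z \<tau>)) w)"

(* Powers of a positive real base x: of_real x powr q = exp (q * of_real (ln x)); the base below is
   positive for tau > 1, the only range in which CM is used. *)
definition CM :: "complex \<Rightarrow> real \<Rightarrow> real \<Rightarrow> real \<Rightarrow> complex" where
  "CM q \<tau> l\<^sub>1 l\<^sub>2 = (let t = complex_of_real \<tau>; a = complex_of_real l\<^sub>1; b = complex_of_real l\<^sub>2 in
     complex_of_real (Gamma (1 / \<tau>) * pi * \<tau> powr (1 / \<tau>) / Gamma (1 - 1 / \<tau>)) powr q
     * Gamma (1 - q / t)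
     * (barnes_Gamma2 (1 - q + t * (1 + a)) \<tau> / barnes_Gamma2 (1 + t * (1 + a)) \<tau>)
     * (barnes_Gamma2 (1 - q + t * (1 + b)) \<tau> / barnes_Gamma2 (1 + t * (1 + b)) \<tau>)
     * (barnes_Gamma2 (1 - q + t) \<tau> / barnes_Gamma2 (1 + t) \<tau>)
     * (barnes_Gamma2 (2 - q + t * (2 + a + b)) \<tau> / barnes_Gamma2 (2 - 2 * q + t * (2 + a + b)) \<tau>)
     * (barnes_Gamma2 (q + 1 + t) \<tau> / barnes_Gamma2 (1 + t) \<tau>)
     * (barnes_Gamma2 (q - t * a) \<tau> / barnes_Gamma2 (- t * a) \<tau>)
     * (barnes_Gamma2 (q - t * b) \<tau> / barnes_Gamma2 (- t * b) \<tau>)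
     * (barnes_Gamma2 (q - 1 - t * (1 + a + b)) \<tau> / barnes_Gamma2 (2 * q - 1 - t * (1 + a + b)) \<tau>))"

end

theory Submission
  imports Defs "HOL-Real_Asymp.Real_Asymp"
begin

text \<open>
  All sixteen arguments of the double gamma factors have positive real part when \<open>\<tau>\<close> is close to \<open>1\<close>, so
  each factor is the exponential of the derivative at \<open>s = 0\<close> of the double zeta function. The classical
  relation at \<open>\<tau> = 1\<close> is \<open>\<Gamma>\<^sub>2(w|1) = C (2\<pi>)\<^bsup>w/2\<^esup> / G(w)\<close>; what has to be shown is that the product of the
  factors is continuous as \<open>\<tau>\<close> tends to \<open>1\<close> and that \<open>\<Gamma>\<^sub>2\<close> may be replaced by \<open>1/G\<close> in the limit.

  The proof rests on a cancellation. Give the arguments \<open>w\<^sub>i\<close> the weights \<open>e\<^sub>i = 1\<close> for numerators and \<open>-1\<close> for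
  denominators. Then \<open>\<Sum> e\<^sub>i = 0\<close> and \<open>\<Sum> e\<^sub>i w\<^sub>i = 0\<close>, whereas \<open>\<Sum> e\<^sub>i w\<^sub>i\<^sup>2 = 2 q (1 + \<tau>)\<close>. The double zeta
  function satisfies
  \<open>\<zeta>\<^sub>2(s, w) - \<zeta>\<^sub>2(s, w + 1) - \<zeta>\<^sub>2(s, w + \<tau>) + \<zeta>\<^sub>2(s, w + 1 + \<tau>) = w\<^bsup>-s\<^esup>\<close>,
  and for \<open>w = 1\<close> the derivative of the right-hand side vanishes. A multiple of this relation can therefore be
  subtracted at no cost, and the right multiple makes the second moment vanish as well.

  If the moments of order \<open>0\<close>, \<open>1\<close>, \<open>2\<close> all vanish, the series \<open>\<Sum>\<^sub>k \<Sum>\<^sub>i e\<^sub>i (w\<^sub>i + k\<^sub>1 + k\<^sub>2 \<tau>)\<^bsup>-s\<^esup>\<close>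
  converges absolutely for \<open>Re s > -1\<close>, by Taylor expansion of order three. It can be differentiated at \<open>s = 0\<close>
  term by term (\<open>weighted_log_barnes_Gamma2_has_sum\<close>), which turns the product of the double gamma factors into
  the exponential of \<open>- \<Sum>\<^sub>k \<Sum>\<^sub>i e\<^sub>i Ln (w\<^sub>i + k\<^sub>1 + k\<^sub>2 \<tau>)\<close>. The majorant is uniform in \<open>\<tau>\<close>, so the limit may be
  taken under the sum (\<open>tendsto_weighted_log_barnes_Gamma2\<close>). For \<open>\<tau> = 1\<close> the terms with \<open>k\<^sub>1 + k\<^sub>2 = n\<close> are
  equal, and \<open>n + 1\<close> in number; this is the logarithm of the canonical product of \<open>G\<close>, whose convergence factors
  are annihilated by the vanishing moments (\<open>weighted_log_barnes_Gamma2_eq_log_barnes_G\<close>). The auxiliary points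
  contribute nothing on this side either, because \<open>G(1) G(3) = G(2)\<^sup>2\<close> (\<open>log_barnes_G_3\<close>).

  The argument presupposes that the double zeta function has a holomorphic continuation to the plane without \<open>1\<close>
  and \<open>2\<close>. This is obtained by the same device: the mixed difference of \<open>z\<^bsup>2-s\<^esup>\<close> telescopes over the lattice,
  and its Taylor expansion expresses \<open>\<zeta>\<^sub>2(s, w)\<close> by the values at \<open>s + 1\<close>, \<open>s + 2\<close> and so on
  (\<open>double_zeta_series_recurrence\<close>).
\<close>

section \<open>Taylor expansion of weighted sums\<close>

text \<open>
  Convergence of all the series below rests on this estimate: if the moments \<open>\<Sum>i. e i * (b i - a) ^ j\<close> vanish for small \<open>j\<close>,
  a weighted sum of values of a function is as small as one of its higher derivatives.
\<close>

lemma weighted_Taylor: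
  fixes f :: "nat \<Rightarrow> complex \<Rightarrow> complex" and e b :: "'i \<Rightarrow> complex"
  assumes S: "convex S" and a: "a \<in> S" and b: "\<And>i. i \<in> I \<Longrightarrow> b i \<in> S"
    and f: "\<And>j z. z \<in> S \<Longrightarrow> j < n \<Longrightarrow> (f j has_field_derivative f (Suc j) z) (at z within S)"
    and B: "\<And>z. z \<in> S \<Longrightarrow> norm (f n z) \<le> B"
  shows "norm ((\<Sum>i\<in>I. e i * f 0 (b i)) - (\<Sum>j<n. f j a / fact j * (\<Sum>i\<in>I. e i * (b i - a) ^ j)))
           \<le> B * (\<Sum>i\<in>I. norm (e i) * norm (b i - a) ^ n)"
proof -
  have B0: "0 \<le> B" using B[OF a] norm_ge_zero order_trans by blast
  have single: "norm (f 0 z - (\<Sum>j<n. f j a * (z - a) ^ j / fact j)) \<le> B * norm (z - a) ^ n"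
    if z: "z \<in> S" for z
  proof (cases n)
    case 0
    then show ?thesis using B[OF z] by simp
  next
    case (Suc k)
    have "norm (f 0 z - (\<Sum>j\<le>k. f j a * (z - a) ^ j / fact j)) \<le> B * norm (z - a) ^ Suc k / fact k"
      by (rule complex_Taylor[OF S _ _ a z]) (use f B Suc in auto)
    also have "\<dots> \<le> B * norm (z - a) ^ Suc k / 1"
      by (intro divide_left_mono mult_nonneg_nonneg B0) (auto simp: fact_ge_1)
    finally show ?thesis by (simp add: Suc lessThan_Suc_atMost)
  qed
  have "(\<Sum>j<n. f j a / fact j * (\<Sum>i\<in>I. e i * (b i - a) ^ j))
        = (\<Sum>i\<in>I. e i * (\<Sum>j<n. f j a * (b i - a) ^ j / fact j))"
    by (subst sum_distrib_left, subst sum.swap) (simp add: sum_distrib_left mult_ac)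
  then have "(\<Sum>i\<in>I. e i * f 0 (b i)) - (\<Sum>j<n. f j a / fact j * (\<Sum>i\<in>I. e i * (b i - a) ^ j))
      = (\<Sum>i\<in>I. e i * (f 0 (b i) - (\<Sum>j<n. f j a * (b i - a) ^ j / fact j)))"
    by (simp add: sum_subtractf algebra_simps)
  also have "norm \<dots> \<le> (\<Sum>i\<in>I. norm (e i) * (B * norm (b i - a) ^ n))"
    by (rule order.trans[OF norm_sum])
       (auto intro!: sum_mono mult_left_mono single b simp: norm_mult)
  finally show ?thesis by (simp add: sum_distrib_left mult_ac)
qed

text \<open>
  The modulus of \<open>z powr (-s)\<close> is \<open>\<bar>z\<bar>\<close> to the power \<open>- Re s\<close>, times \<open>exp (Im s * Arg z)\<close>; the argument is
  bounded by \<open>\<pi>\<close>, so the second factor depends on \<open>s\<close> alone.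
\<close>

lemma norm_powr_half_plane_le:
  fixes z s :: complex
  assumes v: "0 < v" and z: "v \<le> Re z" and s: "0 \<le> Re s"
  shows "norm (z powr (-s)) \<le> exp (pi * \<bar>Im s\<bar>) * v powr (- Re s)"
proof -
  have z0: "z \<noteq> 0" using v z by auto
  have "v \<le> norm z" using z complex_Re_le_cmod[of z] by linarith
  then have 1: "norm z powr (- Re s) \<le> v powr (- Re s)"
    using v s by (intro powr_mono2') auto
  have "Im s * Arg z \<le> \<bar>Im s\<bar> * \<bar>Arg z\<bar>" by (metis abs_ge_self abs_mult)
  also have "\<dots> \<le> \<bar>Im s\<bar> * pi"
    using Arg_le_pi[of z] mpi_less_Arg[of z] by (intro mult_left_mono) auto
  finally have 2: "exp (Im s * Arg z) \<le> exp (pi * \<bar>Im s\<bar>)" by (simp add: mult_ac)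
  show ?thesis
    using mult_mono[OF 1 2] z0 by (simp add: norm_powr_complex mult_ac)
qed

text \<open>
  The \<open>j\<close>-th derivative of \<open>z powr (-s)\<close> is \<open>(-1) ^ j * pochhammer s j * z powr (-s - j)\<close>: each term of the
  expansion gains one power of decay.
\<close>

lemma weighted_powr_Taylor:
  fixes e b :: "'i \<Rightarrow> complex" and a s :: complex
  assumes v: "0 < v" "v \<le> Re a" "\<And>i. i \<in> I \<Longrightarrow> v \<le> Re (b i)" and s: "0 \<le> Re s + n"
  shows "norm ((\<Sum>i\<in>I. e i * b i powr (-s))
            - (\<Sum>j<n. (-1) ^ j * pochhammer s j / fact j * (\<Sum>i\<in>I. e i * (b i - a) ^ j) * a powr (-(s + of_nat j))))
         \<le> norm (pochhammer s n) * exp (pi * \<bar>Im s\<bar>) * v powr (- (Re s + n))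
             * (\<Sum>i\<in>I. norm (e i) * norm (b i - a) ^ n)"
proof -
  define f where "f = (\<lambda>(j::nat) z. (-1) ^ j * pochhammer s j * z powr (-(s + of_nat j)) :: complex)"
  have "norm ((\<Sum>i\<in>I. e i * f 0 (b i)) - (\<Sum>j<n. f j a / fact j * (\<Sum>i\<in>I. e i * (b i - a) ^ j)))
     \<le> (norm (pochhammer s n) * exp (pi * \<bar>Im s\<bar>) * v powr (- (Re s + n))) * (\<Sum>i\<in>I. norm (e i) * norm (b i - a) ^ n)"
  proof (rule weighted_Taylor)
    show "convex {z. v \<le> Re z}" by (rule convex_halfspace_Re_ge)
    show "a \<in> {z. v \<le> Re z}" using v by simp
    show "b i \<in> {z. v \<le> Re z}" if "i \<in> I" for i using v that by simp
  next
    fix j z assume z: "z \<in> {z. v \<le> Re z}" and "j < n"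
    have z0: "z \<notin> \<real>\<^sub>\<le>\<^sub>0" using z v by (auto simp: complex_nonpos_Reals_iff)
    have "(f j has_field_derivative ((-1) ^ j * pochhammer s j * (-(s + of_nat j) * z powr (-(s + of_nat j) - 1)))) (at z)"
      unfolding f_def using z0 by (auto intro!: derivative_eq_intros)
    also have "((-1) ^ j * pochhammer s j * (-(s + of_nat j) * z powr (-(s + of_nat j) - 1))) = f (Suc j) z"
      by (simp add: f_def pochhammer_Suc algebra_simps)
    finally show "(f j has_field_derivative f (Suc j) z) (at z within {z. v \<le> Re z})"
      by (rule has_field_derivative_at_within)
  next
    fix z assume z: "z \<in> {z. v \<le> Re z}"
    have "norm (z powr (-(s + of_nat n))) \<le> exp (pi * \<bar>Im (s + of_nat n)\<bar>) * v powr (- Re (s + of_nat n))"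
      by (rule norm_powr_half_plane_le) (use z v s in auto)
    then show "norm (f n z) \<le> norm (pochhammer s n) * exp (pi * \<bar>Im s\<bar>) * v powr (- (Re s + n))"
      unfolding f_def by (simp add: norm_mult norm_power mult.assoc mult_left_mono)
  qed
  then show ?thesis by (simp add: f_def mult_ac)
qed

lemma weighted_Ln_Taylor:
  fixes e b :: "'i \<Rightarrow> complex" and a :: complex
  assumes v: "0 < v" "v \<le> Re a" "\<And>i. i \<in> I \<Longrightarrow> v \<le> Re (b i)"
  shows "norm ((\<Sum>i\<in>I. e i * Ln (b i))
            - (Ln a * (\<Sum>i\<in>I. e i) + (\<Sum>i\<in>I. e i * (b i - a)) / a - (\<Sum>i\<in>I. e i * (b i - a)\<^sup>2) / (2 * a\<^sup>2)))
         \<le> 2 / v ^ 3 * (\<Sum>i\<in>I. norm (e i) * norm (b i - a) ^ 3)"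
proof -
  define f :: "nat \<Rightarrow> complex \<Rightarrow> complex" where
    "f = (\<lambda>j z. if j = 0 then Ln z else if j = 1 then 1 / z else if j = 2 then - 1 / z\<^sup>2 else 2 / z ^ 3)"
  have "norm ((\<Sum>i\<in>I. e i * f 0 (b i)) - (\<Sum>j<3. f j a / fact j * (\<Sum>i\<in>I. e i * (b i - a) ^ j)))
     \<le> (2 / v ^ 3) * (\<Sum>i\<in>I. norm (e i) * norm (b i - a) ^ 3)"
  proof (rule weighted_Taylor)
    show "convex {z. v \<le> Re z}" by (rule convex_halfspace_Re_ge)
    show "a \<in> {z. v \<le> Re z}" using v by simp
    show "b i \<in> {z. v \<le> Re z}" if "i \<in> I" for i using v that by simp
  next
    fix j :: nat and z assume z: "z \<in> {z. v \<le> Re z}" and j: "j < 3"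
    have z0: "z \<notin> \<real>\<^sub>\<le>\<^sub>0" "z \<noteq> 0" using z v by (auto simp: complex_nonpos_Reals_iff)
    consider "j = 0" | "j = 1" | "j = 2" using j by linarith
    then have "(f j has_field_derivative f (Suc j) z) (at z)"
    proof cases
      case 1
      then show ?thesis using z0
        by (auto simp: f_def field_simps intro!: derivative_eq_intros)
    next
      case 2
      then show ?thesis using z0
        by (auto simp: f_def divide_simps power2_eq_square intro!: derivative_eq_intros)
    next
      case 3
      then show ?thesis using z0
        by (auto simp: f_def divide_simps power2_eq_square power3_eq_cube eval_nat_numeral intro!: derivative_eq_intros)
    qed
    then show "(f j has_field_derivative f (Suc j) z) (at z within {z. v \<le> Re z})"
      by (rule has_field_derivative_at_within)
  next
    fix z assume z: "z \<in> {z. v \<le> Re z}"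
    have vz: "v \<le> norm z" using z complex_Re_le_cmod[of z] by simp
    then have "v ^ 3 \<le> norm z ^ 3" using v by (intro power_mono) auto
    moreover have "0 < norm z" using vz v by linarith
    ultimately
    show "norm (f 3 z) \<le> 2 / v ^ 3"
      using v by (auto simp: f_def norm_divide norm_power intro!: divide_left_mono mult_pos_pos)
  qed
  moreover have "(\<Sum>j<3. f j a / fact j * (\<Sum>i\<in>I. e i * (b i - a) ^ j)) = 
     (Ln a * (\<Sum>i\<in>I. e i) + (\<Sum>i\<in>I. e i * (b i - a)) / a - (\<Sum>i\<in>I. e i * (b i - a)\<^sup>2) / (2 * a\<^sup>2))"
    by (simp add: f_def numeral_3_eq_3 lessThan_Suc power2_eq_square)
  ultimately show ?thesis by (simp add: f_def)
qed

section \<open>Series over the lattice\<close>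

text \<open>
  By the inequality between the arithmetic and the geometric mean, the term at \<open>(i, j)\<close> is at most
  a product of a function of \<open>i\<close> and a function of \<open>j\<close>, each decaying like the power \<open>- p / 2 < -1\<close>.
\<close>

lemma summable_on_lattice_powr:
  fixes p :: real
  assumes "2 < p"
  shows "(\<lambda>k::nat \<times> nat. (1 + real (fst k) + real (snd k)) powr (-p)) summable_on UNIV"
proof -
  define h where "h = (\<lambda>i::nat. (real i + 1/2) powr (- p / 2))"
  have s1: "summable (\<lambda>i::nat. real (Suc i) powr (- p / 2))"
    using assms by (subst summable_Suc_iff) (simp add: summable_real_powr_iff)
  have s2: "norm (h (Suc i)) \<le> real (Suc i) powr (- p / 2)" for i
    unfolding h_def using assms by (auto intro!: powr_mono2')
  have "summable (\<lambda>i. h (Suc i))"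
    by (rule summable_comparison_test'[where N = 0, OF s1 s2])
  then have "summable h" by (rule summable_Suc_iff[THEN iffD1])
  then have h: "h summable_on UNIV"
    by (subst summable_on_UNIV_nonneg_real_iff) (auto simp: h_def)
  have "(\<lambda>(i, j). h i * h j) summable_on UNIV \<times> UNIV"
  proof (rule summable_on_SigmaI)
    show "((\<lambda>j. case (i, j) of (i, j) \<Rightarrow> h i * h j) has_sum (h i * infsum h UNIV)) UNIV" for i
      using has_sum_cmult_right[OF has_sum_infsum[OF h]] by simp
    show "(\<lambda>i. h i * infsum h UNIV) summable_on UNIV"
      by (intro summable_on_cmult_left h)
  qed (auto simp: h_def)
  then have hh: "(\<lambda>k. h (fst k) * h (snd k)) summable_on UNIV"
    by (simp add: case_prod_unfold)
  show ?thesis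
  proof (rule summable_on_comparison_test[OF hh])
    fix k :: "nat \<times> nat"
    define x y where "x = real (fst k) + 1/2" and "y = real (snd k) + 1/2"
    have xy: "0 < x" "0 < y" by (auto simp: x_def y_def)
    have "x * y \<le> (x + y)\<^sup>2" using xy by (simp add: power2_eq_square algebra_simps)
    then have "((x + y)\<^sup>2) powr (- p / 2) \<le> (x * y) powr (- p / 2)"
      using xy assms by (intro powr_mono2') auto
    moreover have "((x + y)\<^sup>2) powr (- p / 2) = (x + y) powr (- p)"
    proof -
      have "((x + y)\<^sup>2) powr (- p / 2) = ((x + y) powr 2) powr (- p / 2)"
        using xy by simp
      also have "\<dots> = (x + y) powr (- p)" by (simp only: powr_powr) simp
      finally show ?thesis .
    qed
    ultimately have "(x + y) powr (-p) \<le> x powr (-p/2) * y powr (-p/2)"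
      using xy by (simp add: powr_mult)
    then show "(1 + real (fst k) + real (snd k)) powr (-p) \<le> h (fst k) * h (snd k)"
      by (simp add: x_def y_def h_def add_ac)
  qed auto
qed

text \<open>
  The M-test gives uniform convergence near each point along the filter of finite index sets; limits
  along any filter that are uniform near each point keep holomorphy and commute with the derivative.
\<close>

lemma holomorphic_infsum:
  fixes f :: "'k \<Rightarrow> complex \<Rightarrow> complex"
  assumes "open A" and hol: "\<And>k. f k holomorphic_on A"
    and bnd: "\<And>z. z \<in> A \<Longrightarrow> \<exists>r>0. \<exists>M. M summable_on UNIV \<and> (\<forall>k. \<forall>x\<in>cball z r \<inter> A. norm (f k x) \<le> M k)"
  shows "(\<lambda>z. \<Sum>\<^sub>\<infinity>k. f k z) holomorphic_on A"
    and "z \<in> A \<Longrightarrow> ((\<lambda>k. deriv (f k) z) has_sum deriv (\<lambda>z. \<Sum>\<^sub>\<infinity>k. f k z) z) UNIV"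
proof -
  define g where "g = (\<lambda>z. \<Sum>\<^sub>\<infinity>k. f k z)"
  have loc: "\<exists>r>0. cball z r \<subseteq> A \<and> uniform_limit (cball z r) (\<lambda>K z. \<Sum>k\<in>K. f k z) g (finite_subsets_at_top UNIV)"
    if "z \<in> A" for z
  proof -
    obtain r M where r: "r > 0" "M summable_on UNIV" "\<And>k x. x \<in> cball z r \<inter> A \<Longrightarrow> norm (f k x) \<le> M k"
      using bnd[OF \<open>z \<in> A\<close>] by blast
    obtain r' where r': "r' > 0" "cball z r' \<subseteq> A"
      using \<open>open A\<close> \<open>z \<in> A\<close> by (meson open_contains_cball)
    have "uniform_limit (cball z (min r r')) (\<lambda>K z. \<Sum>k\<in>K. f k z) g (finite_subsets_at_top UNIV)"
      unfolding g_def using r(2,3) r'(2) by (intro Weierstrass_m_test_general[where M = M]) auto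
    moreover have "cball z (min r r') \<subseteq> A"
      using r'(2) subset_cball[of "min r r'" r' z] by simp
    moreover have "0 < min r r'" using r(1) r'(1) by simp
    ultimately show ?thesis by blast
  qed
  have "g field_differentiable at z" if "z \<in> A" for z
  proof -
    obtain r where r: "r > 0" "cball z r \<subseteq> A" 
      "uniform_limit (cball z r) (\<lambda>K z. \<Sum>k\<in>K. f k z) g (finite_subsets_at_top UNIV)"
      using loc[OF \<open>z \<in> A\<close>] by blast
    have h: "(\<lambda>z. \<Sum>k\<in>K. f k z) holomorphic_on cball z r" for K
      by (intro holomorphic_on_sum holomorphic_on_subset[OF hol r(2)])
    have "\<forall>\<^sub>F K in finite_subsets_at_top UNIV. continuous_on (cball z r) (\<lambda>z. \<Sum>k\<in>K. f k z) \<and>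
             (\<lambda>z. \<Sum>k\<in>K. f k z) holomorphic_on ball z r"
      by (intro always_eventually allI conjI holomorphic_on_imp_continuous_on h holomorphic_on_subset[OF h ball_subset_cball])
    from holomorphic_uniform_limit[OF this r(3)] have "g holomorphic_on ball z r"
      by (metis finite_subsets_at_top_neq_bot)
    then show ?thesis using r(1) by (simp add: holomorphic_on_open field_differentiable_def)
  qed
  then have "g holomorphic_on A"
    using field_differentiable_at_within unfolding holomorphic_on_def by blast
  then show "(\<lambda>z. \<Sum>\<^sub>\<infinity>k. f k z) holomorphic_on A"
    unfolding g_def .
  show "((\<lambda>k. deriv (f k) z) has_sum deriv (\<lambda>z. \<Sum>\<^sub>\<infinity>k. f k z) z) UNIV" if "z \<in> A"
  proof -
    obtain r where r: "r > 0" "cball z r \<subseteq> A" 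
      "uniform_limit (cball z r) (\<lambda>K z. \<Sum>k\<in>K. f k z) g (finite_subsets_at_top UNIV)"
      using loc[OF \<open>z \<in> A\<close>] by blast
    have "((\<lambda>K. deriv (\<lambda>z. \<Sum>k\<in>K. f k z) z) \<longlongrightarrow> deriv g z) (finite_subsets_at_top UNIV)"
    proof (rule deriv_complex_uniform_limit[where A = "ball z r"])
      show "uniform_limit (ball z r) (\<lambda>K z. \<Sum>k\<in>K. f k z) g (finite_subsets_at_top UNIV)"
        by (rule uniform_limit_on_subset[OF r(3) ball_subset_cball])
      show "\<forall>\<^sub>F K in finite_subsets_at_top UNIV. (\<lambda>z. \<Sum>k\<in>K. f k z) holomorphic_on ball z r"
        using order.trans[OF ball_subset_cball r(2)]
        by (intro always_eventually allI holomorphic_on_sum holomorphic_on_subset[OF hol])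
    qed (use r(1) in auto)
    moreover have "deriv (\<lambda>z. \<Sum>k\<in>K. f k z) z = (\<Sum>k\<in>K. deriv (f k) z)" for K
      by (intro deriv_sum holomorphic_on_imp_differentiable_at[OF hol \<open>open A\<close> that])
    ultimately show ?thesis unfolding has_sum_def g_def by simp
  qed
qed

definition lattice_point :: "real \<Rightarrow> nat \<times> nat \<Rightarrow> complex" where
  "lattice_point \<tau> k = of_nat (fst k) + of_nat (snd k) * of_real \<tau>"

text \<open>
  The bound does not depend on \<open>\<tau> \<ge> 1\<close>, so one convergent majorant serves all these \<open>\<tau>\<close> at once.
\<close>

lemma Re_add_lattice_point_ge:
  assumes "1 \<le> \<tau>" "0 < m" "m \<le> 1" "m \<le> Re w"
  shows "m * (1 + real (fst k) + real (snd k)) \<le> Re (w + lattice_point \<tau> k)"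
proof -
  have "m * real (fst k) \<le> real (fst k)" "m * real (snd k) \<le> real (snd k) * 1"
    using assms by (auto simp: mult_left_le_one_le)
  moreover have "real (snd k) * 1 \<le> real (snd k) * \<tau>"
    using assms by (intro mult_left_mono) auto
  ultimately show ?thesis
    using assms unfolding lattice_point_def by (simp add: algebra_simps)
qed

lemma finite_common_lower_bound:
  fixes f :: "'i \<Rightarrow> real"
  assumes "finite I" "\<And>i. i \<in> I \<Longrightarrow> 0 < f i"
  obtains m where "0 < m" "m \<le> 1" "\<And>i. i \<in> I \<Longrightarrow> m \<le> f i"
proof
  show "0 < Min (insert 1 (f ` I))" using assms by (subst Min_gr_iff) auto
  show "Min (insert 1 (f ` I)) \<le> 1" using assms by (intro Min_le) auto
  show "Min (insert 1 (f ` I)) \<le> f i" if "i \<in> I" for i using assms that by (intro Min_le) auto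
qed

text \<open>
  The term at the lattice point \<open>k\<close> of the series attached to the weights \<open>e\<close> and the points \<open>b\<close>, from which
  the first \<open>n\<close> terms of its Taylor expansion around the base point \<open>a\<close> are removed. If the first \<open>n\<close> moments
  vanish, nothing is removed, and the sum over \<open>k\<close> is a weighted sum of double zeta functions.
\<close>

definition powr_Taylor_remainder ::
    "real \<Rightarrow> 'i set \<Rightarrow> ('i \<Rightarrow> complex) \<Rightarrow> ('i \<Rightarrow> complex) \<Rightarrow> complex \<Rightarrow> nat \<Rightarrow> nat \<times> nat \<Rightarrow> complex \<Rightarrow> complex" where
  "powr_Taylor_remainder \<tau> I e b a n k s =
     (\<Sum>i\<in>I. e i * (b i + lattice_point \<tau> k) powr (-s)) -
     (\<Sum>j<n. (-1) ^ j * pochhammer s j / fact j * (\<Sum>i\<in>I. e i * (b i - a) ^ j)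
              * (a + lattice_point \<tau> k) powr (-(s + of_nat j)))"

text \<open>
  The remainder at \<open>k\<close> decays like the power \<open>-(Re s + n)\<close> of the size of \<open>k\<close>, which is summable over the
  two-dimensional lattice as long as \<open>Re s + n > 2\<close>.
\<close>

lemma powr_Taylor_remainder_locally_dominated:
  fixes e b :: "'i \<Rightarrow> complex"
  assumes "finite I" and tau: "1 \<le> \<tau>" and a: "0 < Re a" and b: "\<And>i. i \<in> I \<Longrightarrow> 0 < Re (b i)"
    and c: "2 - real n < Re c"
  shows "\<exists>r>0. \<exists>M. M summable_on UNIV \<and>
           (\<forall>k. \<forall>s\<in>cball c r. norm (powr_Taylor_remainder \<tau> I e b a n k s) \<le> M k)"
proof -
  obtain m0 where m0: "0 < m0" "m0 \<le> 1" "\<And>i. i \<in> I \<Longrightarrow> m0 \<le> Re (b i)"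
    using finite_common_lower_bound[of I "\<lambda>i. Re (b i)"] assms(1) b by blast
  define m where "m = min m0 (Re a)"
  have m: "0 < m" "m \<le> 1" "\<And>i. i \<in> I \<Longrightarrow> m \<le> Re (b i)" "m \<le> Re a"
    using m0 a by (auto simp: m_def intro: min.coboundedI1)
  define N :: "nat \<times> nat \<Rightarrow> real" where "N k = 1 + real (fst k) + real (snd k)" for k
  \<comment> \<open>Half of the margin \<open>Re c + n - 2\<close> is left for the disc, the other half for the decay.\<close>
  define r where "r = (Re c + n - 2) / 2"
  have r: "0 < r" using c by (simp add: r_def)
  define K where "K s = norm (pochhammer s n) * exp (pi * \<bar>Im s\<bar>) * m powr (- (Re s + n))
             * (\<Sum>i\<in>I. norm (e i) * norm (b i - a) ^ n)" for s
  have "continuous_on (cball c r) K"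
    unfolding K_def using m(1) by (intro continuous_intros) auto
  then obtain K0 where K0: "\<And>s. s \<in> cball c r \<Longrightarrow> norm (K s) \<le> K0"
    using compact_continuous_image[THEN compact_imp_bounded, OF _ compact_cball]
    by (metis bounded_iff image_eqI)
  have "norm (powr_Taylor_remainder \<tau> I e b a n k s) \<le> K0 * N k powr (-(2 + r))"
    if s: "s \<in> cball c r" for k s
  proof -
    have "\<bar>Re (c - s)\<bar> \<le> r"
      using s abs_Re_le_cmod[of "c - s"] by (simp add: dist_norm)
    then have "Re c - Re s \<le> r" by simp
    then have Re_s: "2 + r \<le> Re s + n" by (simp add: r_def field_simps)
    have N1: "1 \<le> N k" by (simp add: N_def)
    have "norm (powr_Taylor_remainder \<tau> I e b a n k s)
      \<le> norm (pochhammer s n) * exp (pi * \<bar>Im s\<bar>) * (m * N k) powr (- (Re s + n))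
          * (\<Sum>i\<in>I. norm (e i) * norm ((b i + lattice_point \<tau> k) - (a + lattice_point \<tau> k)) ^ n)"
      unfolding powr_Taylor_remainder_def
      using weighted_powr_Taylor[of "m * N k" "a + lattice_point \<tau> k" I "\<lambda>i. b i + lattice_point \<tau> k" s n e]
        m N1 tau Re_s r Re_add_lattice_point_ge[of \<tau> m]
      by (auto simp: N_def)
    also have "\<dots> = K s * N k powr (- (Re s + n))"
      using m N1 by (simp add: K_def powr_mult mult_ac)
    also have "\<dots> \<le> K0 * N k powr (-(2 + r))"
    proof (rule mult_mono)
      show "K s \<le> K0" using K0[OF s] by simp
      show "0 \<le> K0" using K0[OF s] norm_ge_zero order.trans by blast
      show "N k powr (- (Re s + n)) \<le> N k powr (-(2 + r))" using Re_s N1 by (intro powr_mono) auto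
    qed auto
    finally show ?thesis .
  qed
  moreover have "(\<lambda>k. K0 * N k powr (-(2 + r))) summable_on UNIV"
    unfolding N_def using r by (intro summable_on_cmult_right summable_on_lattice_powr) auto
  ultimately show ?thesis using r by blast
qed

lemma powr_Taylor_remainder_sum:
  fixes e b :: "'i \<Rightarrow> complex"
  assumes "finite I" "1 \<le> \<tau>" "0 < Re a" "\<And>i. i \<in> I \<Longrightarrow> 0 < Re (b i)"
  shows powr_Taylor_remainder_summable: 
      "2 - real n < Re s \<Longrightarrow> (\<lambda>k. powr_Taylor_remainder \<tau> I e b a n k s) summable_on UNIV"
    and holomorphic_powr_Taylor_remainder_sum:
      "(\<lambda>s. \<Sum>\<^sub>\<infinity>k. powr_Taylor_remainder \<tau> I e b a n k s) holomorphic_on {s. 2 - real n < Re s}"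
    and deriv_powr_Taylor_remainder_sum:
      "2 - real n < Re s \<Longrightarrow> ((\<lambda>k. deriv (powr_Taylor_remainder \<tau> I e b a n k) s) has_sum
          deriv (\<lambda>s. \<Sum>\<^sub>\<infinity>k. powr_Taylor_remainder \<tau> I e b a n k s) s) UNIV"
proof -
  have hol: "powr_Taylor_remainder \<tau> I e b a n k holomorphic_on {s. 2 - real n < Re s}" for k
    unfolding powr_Taylor_remainder_def by (intro holomorphic_intros) auto
  have op: "open {s. 2 - real n < Re s}" by (rule open_halfspace_Re_gt)
  have dom: "\<exists>r>0. \<exists>M. M summable_on UNIV \<and>
      (\<forall>k. \<forall>s\<in>cball z r \<inter> {s. 2 - real n < Re s}. norm (powr_Taylor_remainder \<tau> I e b a n k s) \<le> M k)"
    if "z \<in> {s. 2 - real n < Re s}" for z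
  proof -
    obtain r M where "r > 0" "M summable_on UNIV"
      "\<And>k s. s \<in> cball z r \<Longrightarrow> norm (powr_Taylor_remainder \<tau> I e b a n k s) \<le> M k"
      using powr_Taylor_remainder_locally_dominated[where I = I and b = b and c = z and n = n and e = e, OF assms] \<open>z \<in> _\<close>
      by blast
    then show ?thesis by (intro exI[of _ r] conjI exI[of _ M]) auto
  qed
  show "(\<lambda>s. \<Sum>\<^sub>\<infinity>k. powr_Taylor_remainder \<tau> I e b a n k s) holomorphic_on {s. 2 - real n < Re s}"
    by (rule holomorphic_infsum(1)[OF op hol dom])
  show "2 - real n < Re s \<Longrightarrow> ((\<lambda>k. deriv (powr_Taylor_remainder \<tau> I e b a n k) s) has_sum
          deriv (\<lambda>s. \<Sum>\<^sub>\<infinity>k. powr_Taylor_remainder \<tau> I e b a n k s) s) UNIV"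
    by (rule holomorphic_infsum(2)[OF op hol dom]) auto
  assume "2 - real n < Re s"
  then obtain r M where rM: "r > 0" "M summable_on UNIV" "\<And>k z. z \<in> cball s r \<Longrightarrow> norm (powr_Taylor_remainder \<tau> I e b a n k z) \<le> M k"
    using powr_Taylor_remainder_locally_dominated[where I = I and b = b and c = s and n = n and e = e, OF assms] by blast
  show "(\<lambda>k. powr_Taylor_remainder \<tau> I e b a n k s) summable_on UNIV"
    by (rule abs_summable_summable, rule summable_on_comparison_test[OF rM(2)]) (use rM in auto)
qed

definition double_zeta_series :: "real \<Rightarrow> complex \<Rightarrow> complex \<Rightarrow> complex" where
  "double_zeta_series \<tau> w s = (\<Sum>\<^sub>\<infinity>k. (w + lattice_point \<tau> k) powr (-s))"

lemma
  assumes "1 \<le> \<tau>" "0 < Re w"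
  shows double_zeta_series_summable:
      "2 < Re s \<Longrightarrow> (\<lambda>k. (w + lattice_point \<tau> k) powr (-s)) summable_on UNIV"
    and holomorphic_double_zeta_series: "double_zeta_series \<tau> w holomorphic_on {s. 2 < Re s}"
proof -
  \<comment> \<open>Without any Taylor terms the remainder is the term of the series itself.\<close>
  have *: "powr_Taylor_remainder \<tau> {()} (\<lambda>_. 1) (\<lambda>_. w) w 0 k s = (w + lattice_point \<tau> k) powr (-s)" for k s
    by (simp add: powr_Taylor_remainder_def)
  show "2 < Re s \<Longrightarrow> (\<lambda>k. (w + lattice_point \<tau> k) powr (-s)) summable_on UNIV"
    using powr_Taylor_remainder_summable[of "{()}" \<tau> w "\<lambda>_. w" 0 s "\<lambda>_. 1"] assms by (simp add: *)
  show "double_zeta_series \<tau> w holomorphic_on {s. 2 < Re s}"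
    using holomorphic_powr_Taylor_remainder_sum[of "{()}" \<tau> w "\<lambda>_. w" "\<lambda>_. 1" 0] assms
    by (simp add: * double_zeta_series_def[abs_def])
qed

text \<open>
  Two telescoping sums, one in each direction of the lattice. For \<open>\<phi> i j = (w + i + j * \<tau>) powr (2 - s)\<close> the mixed
  difference is summable as soon as \<open>Re s > 2\<close>, but the four terms separately are so only for \<open>Re s > 4\<close>.
\<close>

lemma infsum_mixed_difference:
  fixes \<phi> :: "nat \<Rightarrow> nat \<Rightarrow> complex"
  assumes sum: "(\<lambda>(i, j). \<phi> i j - \<phi> (Suc i) j - \<phi> i (Suc j) + \<phi> (Suc i) (Suc j)) summable_on UNIV"
    and lim1: "\<And>j. (\<lambda>i. \<phi> i j) \<longlonglongrightarrow> 0" and lim2: "\<phi> 0 \<longlonglongrightarrow> 0"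
  shows "(\<Sum>\<^sub>\<infinity>(i, j). \<phi> i j - \<phi> (Suc i) j - \<phi> i (Suc j) + \<phi> (Suc i) (Suc j)) = \<phi> 0 0"
proof -
  define D where "D = (\<lambda>j i. \<phi> i j - \<phi> (Suc i) j - \<phi> i (Suc j) + \<phi> (Suc i) (Suc j))"
  have sumD: "(\<lambda>(j, i). D j i) summable_on UNIV \<times> UNIV"
    using sum by (subst summable_on_swap) (simp add: D_def case_prod_unfold)
  have inner: "(D j has_sum (\<phi> 0 j - \<phi> 0 (Suc j))) UNIV" for j
  proof -
    have "D j summable_on UNIV"
      using summable_on_SigmaD1[OF sumD, of j] by simp
    moreover have "D j sums (\<phi> 0 j - \<phi> 0 (Suc j) - 0)"
      using telescope_sums'[of "\<lambda>i. \<phi> i j - \<phi> i (Suc j)" 0] tendsto_diff[OF lim1[of j] lim1[of "Suc j"]]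
      by (simp add: D_def algebra_simps)
    ultimately show ?thesis
      by (metis diff_zero has_sum_imp_sums has_sum_infsum sums_unique2)
  qed
  have "(\<lambda>j. infsum (D j) UNIV) summable_on UNIV"
    using summable_on_Sigma_banach[OF sumD] by simp
  then have "((\<lambda>j. infsum (D j) UNIV) has_sum (\<Sum>\<^sub>\<infinity>j. \<Sum>\<^sub>\<infinity>i. D j i)) UNIV"
    by (rule has_sum_infsum)
  then have "((\<lambda>j. \<phi> 0 j - \<phi> 0 (Suc j)) has_sum (\<Sum>\<^sub>\<infinity>j. \<Sum>\<^sub>\<infinity>i. D j i)) UNIV"
    by (simp only: infsumI[OF inner])
  then have "(\<Sum>\<^sub>\<infinity>j. \<Sum>\<^sub>\<infinity>i. D j i) = \<phi> 0 0 - 0"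
    using has_sum_imp_sums sums_unique2 telescope_sums'[OF lim2] by blast
  moreover have "(\<Sum>\<^sub>\<infinity>j. \<Sum>\<^sub>\<infinity>i. D j i) = (\<Sum>\<^sub>\<infinity>(j, i)\<in>UNIV \<times> UNIV. D j i)"
    using infsum_Sigma'_banach[OF sumD] by simp
  moreover have "(\<Sum>\<^sub>\<infinity>(j, i)\<in>UNIV \<times> UNIV. D j i) = (\<Sum>\<^sub>\<infinity>(i, j)\<in>UNIV \<times> UNIV. D j i)"
    by (rule infsum_reindex_bij_witness[of _ prod.swap prod.swap]) auto
  ultimately show ?thesis by (simp add: D_def)
qed

section \<open>Analytic continuation of the double zeta function\<close>

lemma powr_of_nat_shift_tendsto_0:
  fixes w s :: complex
  assumes "0 < Re w" "0 < Re s" "0 < c"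
  shows "(\<lambda>i::nat. (w + of_nat i * of_real c) powr (-s)) \<longlonglongrightarrow> 0"
proof (rule Lim_null_comparison)
  show "\<forall>\<^sub>F i in sequentially. norm ((w + of_nat i * of_real c) powr (-s))
          \<le> exp (pi * \<bar>Im s\<bar>) * (Re w + real i * c) powr (- Re s)"
    using assms by (intro always_eventually allI norm_powr_half_plane_le) (auto intro!: add_pos_nonneg)
  have "filterlim (\<lambda>i. real i * c) at_top sequentially"
    by (rule filterlim_at_top_mult_tendsto_pos[OF tendsto_const \<open>0 < c\<close> filterlim_real_sequentially])
  then have "filterlim (\<lambda>i. Re w + real i * c) at_top sequentially"
    by (rule filterlim_tendsto_add_at_top[OF tendsto_const])
  then have "(\<lambda>i. (Re w + real i * c) powr (- Re s)) \<longlonglongrightarrow> 0"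
    using assms by (intro tendsto_neg_powr) auto
  then show "(\<lambda>i. exp (pi * \<bar>Im s\<bar>) * (Re w + real i * c) powr (- Re s)) \<longlonglongrightarrow> 0"
    by (rule tendsto_mult_right_zero)
qed

lemma mixed_difference_powr_has_sum:
  fixes w s :: complex
  assumes tau: "1 \<le> \<tau>" and w: "0 < Re w" and s: "0 < Re s"
    and D: "\<And>k. D k = (w + lattice_point \<tau> k) powr (-s) - (w + 1 + lattice_point \<tau> k) powr (-s)
                     - (w + of_real \<tau> + lattice_point \<tau> k) powr (-s) + (w + 1 + of_real \<tau> + lattice_point \<tau> k) powr (-s)"
    and summable: "D summable_on UNIV"
  shows "(D has_sum w powr (-s)) UNIV"
proof -
  define \<phi> where "\<phi> = (\<lambda>i j. (w + lattice_point \<tau> (i, j)) powr (-s))"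
  have D': "D = (\<lambda>(i, j). \<phi> i j - \<phi> (Suc i) j - \<phi> i (Suc j) + \<phi> (Suc i) (Suc j))"
    by (auto simp: fun_eq_iff D \<phi>_def lattice_point_def algebra_simps)
  have "(\<Sum>\<^sub>\<infinity>(i, j). \<phi> i j - \<phi> (Suc i) j - \<phi> i (Suc j) + \<phi> (Suc i) (Suc j)) = \<phi> 0 0"
  proof (rule infsum_mixed_difference)
    show "(\<lambda>(i, j). \<phi> i j - \<phi> (Suc i) j - \<phi> i (Suc j) + \<phi> (Suc i) (Suc j)) summable_on UNIV"
      using summable by (simp add: D')
    show "(\<lambda>i. \<phi> i j) \<longlonglongrightarrow> 0" for j
    proof -
      have "0 < Re (w + of_nat j * of_real \<tau>)" using w tau by (simp add: add_pos_nonneg)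
      from powr_of_nat_shift_tendsto_0[OF this s, of 1] show ?thesis
        by (simp add: \<phi>_def lattice_point_def add_ac)
    qed
    show "\<phi> 0 \<longlonglongrightarrow> 0"
      using powr_of_nat_shift_tendsto_0[OF w s, of \<tau>] tau by (simp add: \<phi>_def lattice_point_def)
  qed
  then have "infsum D UNIV = w powr (-s)"
    by (simp add: D' \<phi>_def lattice_point_def)
  then show ?thesis using has_sum_infsum[OF summable] by simp
qed

lemma has_sum_finite_sum:
  fixes f :: "'j \<Rightarrow> 'k \<Rightarrow> complex"
  assumes "\<And>j. j \<in> J \<Longrightarrow> (f j has_sum S j) A"
  shows "((\<lambda>k. \<Sum>j\<in>J. f j k) has_sum (\<Sum>j\<in>J. S j)) A"
  using assms by (induction J rule: infinite_finite_induct) (auto intro!: has_sum_add)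

text \<open>
  The mixed second difference over one cell of the lattice spanned by \<open>1\<close> and \<open>\<tau>\<close>, written as a weighted
  sum over the four vertices of the cell.
\<close>

definition cell_weight :: "nat \<Rightarrow> complex" where
  "cell_weight i = [1, -1, -1, 1] ! i"

definition cell_vertex :: "real \<Rightarrow> nat \<Rightarrow> complex" where
  "cell_vertex \<tau> i = [0, 1, of_real \<tau>, 1 + of_real \<tau>] ! i"

lemma sum_cell:
  "(\<Sum>i<4. cell_weight i * f (cell_vertex \<tau> i)) = f 0 - f 1 - f (of_real \<tau>) + f (1 + of_real \<tau>)"
  by (simp add: eval_nat_numeral cell_weight_def cell_vertex_def)

definition cell_moment :: "real \<Rightarrow> nat \<Rightarrow> complex" where
  "cell_moment \<tau> j = (\<Sum>i<4. cell_weight i * cell_vertex \<tau> i ^ j)"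

lemma cell_moment_simps:
  "cell_moment \<tau> 0 = 0" "cell_moment \<tau> (Suc 0) = 0" "cell_moment \<tau> 2 = 2 * of_real \<tau>"
  unfolding cell_moment_def sum_cell[where f = "\<lambda>x. x ^ _"]
  by (auto simp: power2_eq_square algebra_simps)

definition cell_remainder :: "real \<Rightarrow> complex \<Rightarrow> nat \<Rightarrow> complex \<Rightarrow> complex" where
  "cell_remainder \<tau> w n s =
     (\<Sum>\<^sub>\<infinity>k. powr_Taylor_remainder \<tau> {..<4} cell_weight (\<lambda>i. w + cell_vertex \<tau> i) w n k s)"

lemma Re_cell_vertex_nonneg:
  assumes "1 \<le> \<tau>" "i < 4"
  shows "0 \<le> Re (cell_vertex \<tau> i)"
proof -
  have "i = 0 \<or> i = 1 \<or> i = 2 \<or> i = 3" using assms(2) by linarith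
  then show ?thesis using assms(1) by (auto simp: cell_vertex_def eval_nat_numeral)
qed

text \<open>
  Take the mixed difference of \<open>z powr (2 - s)\<close> over the cell at each lattice point. Summed over the
  lattice these telescope to \<open>w powr (2 - s)\<close>. Expanded in Taylor series at the lattice points they give a
  combination of the double zeta function at \<open>s\<close>, \<open>s + 1\<close>, \<open>s + 2\<close> and so on, plus a remainder that converges
  further to the left. Multiplication by \<open>(s - 1) * (s - 2)\<close> leaves only polynomial coefficients, so no
  poles have to be tracked.
\<close>

lemma double_zeta_series_recurrence:
  fixes w s :: complex
  assumes tau: "1 \<le> \<tau>" and w: "0 < Re w" and s: "2 < Re s" and n: "3 \<le> n"
  shows "of_real \<tau> * ((s - 1) * (s - 2) * double_zeta_series \<tau> w s) =
     w powr (2 - s) - cell_remainder \<tau> w n (s - 2)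
     - (\<Sum>j=3..<n. (-1) ^ j * cell_moment \<tau> j / fact j * pochhammer (s - 2) (j - 2)
          * ((s - 2 + of_nat j - 1) * (s - 2 + of_nat j - 2) * double_zeta_series \<tau> w (s - 2 + of_nat j)))"
proof -
  define t where "t = s - 2"
  define R where "R = (\<lambda>k. powr_Taylor_remainder \<tau> {..<4} cell_weight (\<lambda>i. w + cell_vertex \<tau> i) w n k t)"
  define c where "c = (\<lambda>j. (-1) ^ j * pochhammer t j / fact j * cell_moment \<tau> j)"
  define D where "D = (\<lambda>k. \<Sum>i<4. cell_weight i * (w + cell_vertex \<tau> i + lattice_point \<tau> k) powr (-t))"
  have t: "0 < Re t" using s by (simp add: t_def)
  have R: "R k = D k - (\<Sum>j<n. c j * (w + lattice_point \<tau> k) powr (-(t + of_nat j)))" for k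
    by (simp add: R_def powr_Taylor_remainder_def D_def c_def cell_moment_def mult_ac)
  have n': "{..<n} = {0, 1} \<union> {2..<n}" using n by auto
  have c_sum: "(\<Sum>j<n. c j * f j) = (\<Sum>j=2..<n. c j * f j)" for f
    unfolding n' by (subst sum.union_disjoint) (auto simp: c_def cell_moment_simps)
  have "R summable_on UNIV"
    unfolding R_def using w Re_cell_vertex_nonneg[OF tau] tau n t
    by (intro powr_Taylor_remainder_summable) (auto intro!: add_pos_nonneg)
  then have sumR: "(R has_sum cell_remainder \<tau> w n t) UNIV"
    unfolding cell_remainder_def R_def by (rule has_sum_infsum)
  have "((\<lambda>k. \<Sum>j=2..<n. c j * (w + lattice_point \<tau> k) powr (-(t + of_nat j))) has_sum
            (\<Sum>j=2..<n. c j * double_zeta_series \<tau> w (t + of_nat j))) UNIV"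
    unfolding double_zeta_series_def using t
    by (intro has_sum_finite_sum has_sum_cmult_right has_sum_infsum double_zeta_series_summable tau w) auto
  from has_sum_add[OF sumR this]
  have sumD: "(D has_sum (cell_remainder \<tau> w n t + (\<Sum>j=2..<n. c j * double_zeta_series \<tau> w (t + of_nat j)))) UNIV"
    by (simp add: R c_sum)
  have "(D has_sum w powr (-t)) UNIV"
  proof (rule mixed_difference_powr_has_sum[OF tau w t])
    show "D summable_on UNIV" using sumD has_sum_imp_summable by blast
    show "D k = (w + lattice_point \<tau> k) powr (-t) - (w + 1 + lattice_point \<tau> k) powr (-t)
               - (w + of_real \<tau> + lattice_point \<tau> k) powr (-t) + (w + 1 + of_real \<tau> + lattice_point \<tau> k) powr (-t)" for k
      unfolding D_def using sum_cell[of "\<lambda>x. (w + x + lattice_point \<tau> k) powr (-t)" \<tau>] by (simp add: add_ac)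
  qed
  from has_sum_unique[OF this sumD]
  have "w powr (-t) = cell_remainder \<tau> w n t + (\<Sum>j=2..<n. c j * double_zeta_series \<tau> w (t + of_nat j))" .
  also have "(\<Sum>j=2..<n. c j * double_zeta_series \<tau> w (t + of_nat j)) =
       c 2 * double_zeta_series \<tau> w s + (\<Sum>j=3..<n. c j * double_zeta_series \<tau> w (t + of_nat j))"
    using n by (subst sum.atLeast_Suc_lessThan) (auto simp: t_def eval_nat_numeral)
  also have "c 2 = of_real \<tau> * ((s - 1) * (s - 2))"
    by (simp add: c_def t_def cell_moment_simps(3)[unfolded numeral_2_eq_2] numeral_2_eq_2 pochhammer_Suc)
  also have "(\<Sum>j=3..<n. c j * double_zeta_series \<tau> w (t + of_nat j)) =
     (\<Sum>j=3..<n. (-1) ^ j * cell_moment \<tau> j / fact j * pochhammer t (j - 2)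
          * ((t + of_nat j - 1) * (t + of_nat j - 2) * double_zeta_series \<tau> w (t + of_nat j)))"
  proof (rule sum.cong[OF refl])
    fix j assume "j \<in> {3..<n}"
    then have "j = Suc (Suc (j - 2))" unfolding atLeastLessThan_iff by arith
    then obtain i where i: "j = Suc (Suc i)" by blast
    \<comment> \<open>The last two factors of the rising factorial are those that remove the poles at \<open>t + j = 1, 2\<close>.\<close>
    have "pochhammer t j = pochhammer t (j - 2) * ((t + of_nat j - 1) * (t + of_nat j - 2))"
      by (simp add: i pochhammer_Suc algebra_simps)
    then show "c j * double_zeta_series \<tau> w (t + of_nat j) = (-1) ^ j * cell_moment \<tau> j / fact j * pochhammer t (j - 2)
          * ((t + of_nat j - 1) * (t + of_nat j - 2) * double_zeta_series \<tau> w (t + of_nat j))"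
      by (simp add: c_def)
  qed
  finally show ?thesis by (simp add: t_def algebra_simps)
qed

text \<open>
  On the right-hand side of the recurrence the function occurs only at arguments with real part at least
  \<open>Re s + 1\<close>, so each application extends it by a strip of width one.
\<close>

lemma double_zeta_continuation_half_plane:
  fixes w :: complex
  assumes tau: "1 \<le> \<tau>" and w: "0 < Re w"
  shows "\<exists>E. E holomorphic_on {s. 2 - real M < Re s} \<and>
             (\<forall>s. 2 < Re s \<longrightarrow> E s = (s - 1) * (s - 2) * double_zeta_series \<tau> w s)"
proof (induction M)
  case 0
  show ?case
    using holomorphic_double_zeta_series[OF tau w]
    by (intro exI[of _ "\<lambda>s. (s - 1) * (s - 2) * double_zeta_series \<tau> w s"]) (auto intro!: holomorphic_intros)
next
  case (Suc M)
  then obtain E where E: "E holomorphic_on {s. 2 - real M < Re s}"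
      "\<And>s. 2 < Re s \<Longrightarrow> E s = (s - 1) * (s - 2) * double_zeta_series \<tau> w s" by blast
  \<comment> \<open>The remainder of order \<open>n\<close> at \<open>s - 2\<close> is holomorphic for \<open>Re s > 4 - n\<close>, that is for \<open>Re s > 1 - M\<close>.\<close>
  define n where "n = M + 3"
  define E' where "E' = (\<lambda>s. (w powr (2 - s) - cell_remainder \<tau> w n (s - 2)
     - (\<Sum>j=3..<n. (-1) ^ j * cell_moment \<tau> j / fact j * pochhammer (s - 2) (j - 2) * E (s - 2 + of_nat j))) / of_real \<tau>)"
  have "cell_remainder \<tau> w n holomorphic_on {s. 2 - real n < Re s}"
    unfolding cell_remainder_def[abs_def] using w Re_cell_vertex_nonneg[OF tau] tau
    by (intro holomorphic_powr_Taylor_remainder_sum) (auto intro!: add_pos_nonneg)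
  then have "cell_remainder \<tau> w n \<circ> (\<lambda>s. s - 2) holomorphic_on {s. 2 - real (Suc M) < Re s}"
    by (intro holomorphic_on_compose_gen) (auto intro!: holomorphic_intros simp: n_def)
  moreover have "E \<circ> (\<lambda>s. s - 2 + of_nat j) holomorphic_on {s. 2 - real (Suc M) < Re s}" if "j \<in> {3..<n}" for j
    by (intro holomorphic_on_compose_gen[OF _ E(1)]) (use that in \<open>auto intro!: holomorphic_intros\<close>)
  ultimately have "E' holomorphic_on {s. 2 - real (Suc M) < Re s}"
    unfolding E'_def o_def using tau by (intro holomorphic_intros) auto
  moreover have "E' s = (s - 1) * (s - 2) * double_zeta_series \<tau> w s" if s: "2 < Re s" for s
  proof -
    have "E (s - 2 + of_nat j) = (s - 2 + of_nat j - 1) * (s - 2 + of_nat j - 2) * double_zeta_series \<tau> w (s - 2 + of_nat j)"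
      if "j \<in> {3..<n}" for j
      using s that by (intro E(2)) auto
    then have "of_real \<tau> * E' s = w powr (2 - s) - cell_remainder \<tau> w n (s - 2)
        - (\<Sum>j=3..<n. (-1) ^ j * cell_moment \<tau> j / fact j * pochhammer (s - 2) (j - 2)
          * ((s - 2 + of_nat j - 1) * (s - 2 + of_nat j - 2) * double_zeta_series \<tau> w (s - 2 + of_nat j)))"
      unfolding E'_def using tau by simp
    also have "\<dots> = of_real \<tau> * ((s - 1) * (s - 2) * double_zeta_series \<tau> w s)"
      by (rule double_zeta_series_recurrence[OF tau w s, symmetric]) (simp add: n_def)
    finally have "of_real \<tau> * E' s = of_real \<tau> * ((s - 1) * (s - 2) * double_zeta_series \<tau> w s)" .
    then show ?thesis using tau by simp
  qed
  ultimately show ?case by blast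
qed

text \<open>
  The continuations to the half-planes agree where both are defined, by the identity theorem, and so
  glue to an entire function.
\<close>

lemma double_zeta_continuation:
  fixes w :: complex
  assumes tau: "1 \<le> \<tau>" and w: "0 < Re w"
  shows "\<exists>E. E holomorphic_on UNIV \<and>
             (\<forall>s. 2 < Re s \<longrightarrow> E s = (s - 1) * (s - 2) * double_zeta_series \<tau> w s)"
proof -
  define H where "H M = {s. 2 - real M < Re s}" for M
  have H: "open (H M)" "connected (H M)" "{s. 2 < Re s} \<subseteq> H M" for M
    by (auto simp: H_def open_halfspace_Re_gt convex_halfspace_Re_gt convex_connected)
  obtain E where E: "\<And>M. E M holomorphic_on H M"
      "\<And>M s. 2 < Re s \<Longrightarrow> E M s = (s - 1) * (s - 2) * double_zeta_series \<tau> w s"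
    using double_zeta_continuation_half_plane[OF tau w] unfolding H_def by metis
  have mono: "E M s = E M' s" if "M \<le> M'" "s \<in> H M" for M M' s
  proof (rule analytic_continuation_open[of "{s. 2 < Re s}" "H M" "E M" "E M'"])
    show "E M' holomorphic_on H M" by (rule holomorphic_on_subset[OF E(1)]) (use that in \<open>auto simp: H_def\<close>)
    have "3 \<in> {s. 2 < Re s}" by simp
    then show "{s. 2 < Re s} \<noteq> {}" by blast
  qed (use H E that in \<open>auto simp: open_halfspace_Re_gt\<close>)
  then have agree: "E M s = E M' s" if "s \<in> H M" "s \<in> H M'" for M M' s
    using that by (metis nat_le_linear)
  \<comment> \<open>The index is one for which \<open>s\<close> lies in the half-plane \<open>H M\<close>.\<close>
  define F where "F s = E (nat \<lceil>3 - Re s\<rceil>) s" for s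
  have inH: "s \<in> H (nat \<lceil>3 - Re s\<rceil>)" for s
    unfolding H_def by (simp, linarith)
  have "F field_differentiable at s" for s
  proof -
    have "F holomorphic_on H (nat \<lceil>3 - Re s\<rceil>)"
      by (rule holomorphic_transform[OF E(1)]) (auto simp: F_def intro: agree inH)
    then show ?thesis using H(1) inH holomorphic_on_imp_differentiable_at by blast
  qed
  then have "F holomorphic_on UNIV" by (simp add: holomorphic_on_def)
  moreover have "F s = (s - 1) * (s - 2) * double_zeta_series \<tau> w s" if "2 < Re s" for s
    using E(2)[OF that] by (simp add: F_def)
  ultimately show ?thesis by blast
qed

text \<open>
  Division of the entire function by \<open>(s - 1) * (s - 2)\<close> gives a function as required in the definition of
  \<open>barnes_zeta2\<close>, so the one chosen there has the required properties.
\<close>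

lemma barnes_zeta2_continuation:
  assumes tau: "1 \<le> \<tau>" and w: "0 < Re w"
  shows holomorphic_barnes_zeta2: "barnes_zeta2 \<tau> w holomorphic_on (UNIV - {1, 2})"
    and barnes_zeta2_eq_series: "2 < Re s \<Longrightarrow> barnes_zeta2 \<tau> w s = double_zeta_series \<tau> w s"
proof -
  obtain E where E: "E holomorphic_on UNIV"
      "\<And>s. 2 < Re s \<Longrightarrow> E s = (s - 1) * (s - 2) * double_zeta_series \<tau> w s"
    using double_zeta_continuation[OF tau w] by blast
  have "(\<lambda>s. E s / ((s - 1) * (s - 2))) holomorphic_on (UNIV - {1, 2})"
    by (intro holomorphic_intros holomorphic_on_subset[OF E(1)]) auto
  moreover have "E s / ((s - 1) * (s - 2)) = double_zeta_series \<tau> w s" if "2 < Re s" for s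
    using E(2)[OF that] that by auto
  ultimately have ex: "\<exists>f. f holomorphic_on (UNIV - {1, 2}) \<and> (\<forall>s. Re s > 2 \<longrightarrow> f s = double_zeta_series \<tau> w s)"
    by blast
  have "barnes_zeta2 \<tau> w = (SOME f. f holomorphic_on (UNIV - {1, 2}) \<and> (\<forall>s. Re s > 2 \<longrightarrow> f s = double_zeta_series \<tau> w s))"
    unfolding barnes_zeta2_def double_zeta_series_def lattice_point_def
    by (simp add: case_prod_unfold add.assoc)
  with someI_ex[OF ex]
  have "barnes_zeta2 \<tau> w holomorphic_on (UNIV - {1, 2}) \<and> (\<forall>s. Re s > 2 \<longrightarrow> barnes_zeta2 \<tau> w s = double_zeta_series \<tau> w s)"
    by simp
  then show "barnes_zeta2 \<tau> w holomorphic_on (UNIV - {1, 2})"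
    and "2 < Re s \<Longrightarrow> barnes_zeta2 \<tau> w s = double_zeta_series \<tau> w s" by auto
qed

section \<open>The logarithm of the double gamma function\<close>

text \<open>
  On the right half-plane this is a logarithm of \<open>barnes_Gamma2\<close>; it comes with a definite branch.
\<close>

definition log_barnes_Gamma2 :: "real \<Rightarrow> complex \<Rightarrow> complex" where
  "log_barnes_Gamma2 \<tau> w = deriv (barnes_zeta2 \<tau> w) 0"

lemma barnes_Gamma2_eq_exp: "0 < Re w \<Longrightarrow> barnes_Gamma2 w \<tau> = exp (log_barnes_Gamma2 \<tau> w)"
  by (simp add: barnes_Gamma2_def barnes_Gamma2_right_def log_barnes_Gamma2_def)

lemma barnes_zeta2_differentiable_at_0:
  assumes "1 \<le> \<tau>" "0 < Re w"
  shows "barnes_zeta2 \<tau> w field_differentiable at 0"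
  by (rule holomorphic_on_imp_differentiable_at[OF holomorphic_barnes_zeta2[OF assms]])
     (auto intro: open_Diff)

lemma has_field_derivative_powr_minus_at_0:
  fixes v :: complex
  assumes "v \<noteq> 0"
  shows "((\<lambda>s. v powr (-s)) has_field_derivative - Ln v) (at 0)"
proof -
  have "(\<lambda>s. v powr (-s)) = (\<lambda>s. exp (- s * Ln v))"
    using assms by (simp add: powr_def)
  then show ?thesis by (auto intro!: derivative_eq_intros)
qed

text \<open>
  The mixed difference of the double zeta series telescopes to \<open>w powr (-s)\<close>, an entire function of \<open>s\<close>, so the
  identity persists at \<open>s = 0\<close>.
\<close>

lemma log_barnes_Gamma2_mixed_difference:
  assumes tau: "1 \<le> \<tau>" and w: "0 < Re w"
  shows "log_barnes_Gamma2 \<tau> w - log_barnes_Gamma2 \<tau> (w + 1) - log_barnes_Gamma2 \<tau> (w + of_real \<tau>)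
           + log_barnes_Gamma2 \<tau> (w + 1 + of_real \<tau>) = - Ln w"
proof -
  define F where "F = (\<lambda>s. barnes_zeta2 \<tau> w s - barnes_zeta2 \<tau> (w + 1) s - barnes_zeta2 \<tau> (w + of_real \<tau>) s
           + barnes_zeta2 \<tau> (w + 1 + of_real \<tau>) s)"
  have pos: "0 < Re (w + 1)" "0 < Re (w + of_real \<tau>)" "0 < Re (w + 1 + of_real \<tau>)"
    using tau w by auto
  have F_series: "F s = w powr (-s)" if s: "2 < Re s" for s
  proof -
    define D where "D = (\<lambda>k. (w + lattice_point \<tau> k) powr (-s) - (w + 1 + lattice_point \<tau> k) powr (-s)
        - (w + of_real \<tau> + lattice_point \<tau> k) powr (-s) + (w + 1 + of_real \<tau> + lattice_point \<tau> k) powr (-s))"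
    have hs: "((\<lambda>k. (v + lattice_point \<tau> k) powr (-s)) has_sum barnes_zeta2 \<tau> v s) UNIV" if "0 < Re v" for v
      unfolding barnes_zeta2_eq_series[OF tau that s] double_zeta_series_def
      by (intro has_sum_infsum double_zeta_series_summable tau that s)
    have "((\<lambda>k. (w + lattice_point \<tau> k) powr (-s) + - ((w + 1 + lattice_point \<tau> k) powr (-s))
        + - ((w + of_real \<tau> + lattice_point \<tau> k) powr (-s)) + (w + 1 + of_real \<tau> + lattice_point \<tau> k) powr (-s))
       has_sum (barnes_zeta2 \<tau> w s + - barnes_zeta2 \<tau> (w + 1) s + - barnes_zeta2 \<tau> (w + of_real \<tau>) s
           + barnes_zeta2 \<tau> (w + 1 + of_real \<tau>) s)) UNIV"
      by (intro has_sum_add has_sum_uminusI hs w pos)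
    then have sumD: "(D has_sum F s) UNIV"
      by (simp add: D_def F_def)
    have "(D has_sum w powr (-s)) UNIV"
      using has_sum_imp_summable[OF sumD] s
      by (intro mixed_difference_powr_has_sum[OF tau w]) (auto simp: D_def)
    with sumD show ?thesis using has_sum_unique by blast
  qed
  have F_eq: "F s = w powr (-s)" if "s \<in> UNIV - {1, 2}" for s
  proof (rule analytic_continuation_open[of "{s. 2 < Re s}" "UNIV - {1, 2}" F "\<lambda>s. w powr (-s)"])
    have "3 \<in> {s. 2 < Re s}" by simp
    then show "{s. 2 < Re s} \<noteq> {}" by blast
    show "connected (UNIV - {1, 2} :: complex set)"
      by (rule connected_open_delete_finite) auto
    show "F holomorphic_on UNIV - {1, 2}"
      unfolding F_def by (intro holomorphic_intros holomorphic_barnes_zeta2 tau w pos)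
  qed (use that in \<open>auto simp: open_halfspace_Re_gt F_series intro!: holomorphic_intros\<close>)
  have "deriv F 0 = deriv (\<lambda>s. w powr (-s)) 0"
  proof (rule deriv_cong_ev)
    have "\<forall>\<^sub>F s in nhds 0. s \<in> UNIV - {1, 2 :: complex}"
      by (rule eventually_nhds_in_open) auto
    then show "\<forall>\<^sub>F s in nhds 0. F s = w powr (-s)" by eventually_elim (rule F_eq)
  qed simp
  also have "deriv (\<lambda>s. w powr (-s)) 0 = - Ln w"
    using w by (intro DERIV_imp_deriv has_field_derivative_powr_minus_at_0) auto
  finally have "deriv F 0 = - Ln w" .
  moreover have "(F has_field_derivative (log_barnes_Gamma2 \<tau> w - log_barnes_Gamma2 \<tau> (w + 1)
           - log_barnes_Gamma2 \<tau> (w + of_real \<tau>) + log_barnes_Gamma2 \<tau> (w + 1 + of_real \<tau>))) (at 0)"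
    unfolding F_def log_barnes_Gamma2_def
    by (intro DERIV_add DERIV_diff barnes_zeta2_differentiable_at_0[THEN field_differentiable_derivI] tau w pos)
  ultimately show ?thesis using DERIV_imp_deriv by metis
qed

lemma centred_moments_eq_0:
  fixes e b :: "'i \<Rightarrow> complex"
  assumes "(\<Sum>i\<in>I. e i) = 0" "(\<Sum>i\<in>I. e i * b i) = 0" "(\<Sum>i\<in>I. e i * (b i)\<^sup>2) = 0"
  shows "(\<Sum>i\<in>I. e i * (b i - c)) = 0" "(\<Sum>i\<in>I. e i * (b i - c)\<^sup>2) = 0"
proof -
  show "(\<Sum>i\<in>I. e i * (b i - c)) = 0"
    using assms by (simp add: right_diff_distrib sum_subtractf flip: sum_distrib_right)
  have "(\<Sum>i\<in>I. e i * (b i - c)\<^sup>2) =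
      (\<Sum>i\<in>I. e i * (b i)\<^sup>2) - 2 * c * (\<Sum>i\<in>I. e i * b i) + c\<^sup>2 * (\<Sum>i\<in>I. e i)"
    unfolding sum_distrib_left sum_subtractf[symmetric] sum.distrib[symmetric]
    by (intro sum.cong refl) (simp add: power2_eq_square algebra_simps)
  then show "(\<Sum>i\<in>I. e i * (b i - c)\<^sup>2) = 0" using assms by simp
qed

text \<open>
  Three vanishing moments make the weighted sum of the double zeta series converge for \<open>Re s > -1\<close>. This
  region contains \<open>0\<close>, so by the identity theorem the derivative of the continuation at \<open>0\<close> is the sum of the
  derivatives of the terms, and these are logarithms.
\<close>

lemma weighted_log_barnes_Gamma2_has_sum:
  fixes e b :: "'i \<Rightarrow> complex"
  assumes fin: "finite I" and tau: "1 \<le> \<tau>" and pos: "\<And>i. i \<in> I \<Longrightarrow> 0 < Re (b i)"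
    and moments: "(\<Sum>i\<in>I. e i) = 0" "(\<Sum>i\<in>I. e i * b i) = 0" "(\<Sum>i\<in>I. e i * (b i)\<^sup>2) = 0"
  shows "((\<lambda>k. \<Sum>i\<in>I. e i * Ln (b i + lattice_point \<tau> k)) has_sum
            - (\<Sum>i\<in>I. e i * log_barnes_Gamma2 \<tau> (b i))) UNIV"
proof -
  note centred = centred_moments_eq_0[OF moments, of 1]
  define T where "T = (\<lambda>k s. \<Sum>i\<in>I. e i * (b i + lattice_point \<tau> k) powr (-s))"
  have rem: "powr_Taylor_remainder \<tau> I e b 1 3 k = T k" for k
    using moments(1) centred by (simp add: fun_eq_iff powr_Taylor_remainder_def T_def eval_nat_numeral)
  define H where "H = (\<lambda>s. \<Sum>\<^sub>\<infinity>k. T k s)"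
  define F where "F = (\<lambda>s. \<Sum>i\<in>I. e i * barnes_zeta2 \<tau> (b i) s)"
  have holH: "H holomorphic_on {s. -1 < Re s}"
    using holomorphic_powr_Taylor_remainder_sum[where I = I and b = b and e = e and n = 3 and a = 1 and \<tau> = \<tau>] fin tau pos
    by (simp add: rem H_def)
  have holF: "F holomorphic_on UNIV - {1, 2}"
    unfolding F_def by (intro holomorphic_intros holomorphic_barnes_zeta2 tau pos)
  have FH: "F s = H s" if s: "2 < Re s" for s
  proof -
    have "((\<lambda>k. T k s) has_sum F s) UNIV"
      unfolding T_def F_def
    proof (intro has_sum_finite_sum has_sum_cmult_right)
      show "((\<lambda>k. (b i + lattice_point \<tau> k) powr (-s)) has_sum barnes_zeta2 \<tau> (b i) s) UNIV" if "i \<in> I" for i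
        unfolding barnes_zeta2_eq_series[OF tau pos[OF that] s] double_zeta_series_def
        by (intro has_sum_infsum double_zeta_series_summable tau pos that s)
    qed
    then show ?thesis by (simp add: H_def infsumI)
  qed
  have F_eq: "F s = H s" if "s \<in> {s. -1 < Re s} - {1, 2}" for s
  proof (rule analytic_continuation_open[of "{s. 2 < Re s}" "{s. -1 < Re s} - {1, 2}" F H])
    have "3 \<in> {s. 2 < Re s}" by simp
    then show "{s. 2 < Re s} \<noteq> {}" by blast
    show "connected ({s. -1 < Re s} - {1, 2} :: complex set)"
      by (rule connected_open_delete_finite)
         (auto simp: open_halfspace_Re_gt convex_halfspace_Re_gt convex_connected)
    show "F holomorphic_on {s. -1 < Re s} - {1, 2}" by (rule holomorphic_on_subset[OF holF]) auto
    show "H holomorphic_on {s. -1 < Re s} - {1, 2}" by (rule holomorphic_on_subset[OF holH]) auto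
    show "open ({s. -1 < Re s} - {1, 2} :: complex set)"
      by (intro open_Diff open_halfspace_Re_gt) auto
  qed (use that FH in \<open>auto simp: open_halfspace_Re_gt\<close>)
  have "deriv F 0 = deriv H 0"
  proof (rule deriv_cong_ev)
    have "\<forall>\<^sub>F s in nhds 0. s \<in> {s. -1 < Re s} - {1, 2 :: complex}"
      by (rule eventually_nhds_in_open) (auto intro!: open_Diff open_halfspace_Re_gt)
    then show "\<forall>\<^sub>F s in nhds 0. F s = H s" by eventually_elim (rule F_eq)
  qed simp
  moreover have "deriv F 0 = (\<Sum>i\<in>I. e i * log_barnes_Gamma2 \<tau> (b i))"
    unfolding F_def log_barnes_Gamma2_def
    by (intro DERIV_imp_deriv DERIV_sum DERIV_cmult
          barnes_zeta2_differentiable_at_0[THEN field_differentiable_derivI] tau pos)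
  moreover have "((\<lambda>k. deriv (T k) 0) has_sum deriv H 0) UNIV"
    using deriv_powr_Taylor_remainder_sum[where I = I and b = b and e = e and n = 3 and a = 1 and \<tau> = \<tau> and s = 0] fin tau pos
    by (simp add: rem H_def)
  moreover have "deriv (T k) 0 = - (\<Sum>i\<in>I. e i * Ln (b i + lattice_point \<tau> k))" for k
  proof -
    have nz: "b i + lattice_point \<tau> k \<noteq> 0" if "i \<in> I" for i
    proof -
      have "0 \<le> Re (lattice_point \<tau> k)" using tau by (simp add: lattice_point_def)
      then have "0 < Re (b i + lattice_point \<tau> k)" using pos[OF that] by simp
      then show ?thesis by force
    qed
    have "(T k has_field_derivative (\<Sum>i\<in>I. e i * (- Ln (b i + lattice_point \<tau> k)))) (at 0)"
      unfolding T_def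
    proof (intro DERIV_sum DERIV_cmult)
      show "((\<lambda>s. (b i + lattice_point \<tau> k) powr (-s)) has_field_derivative - Ln (b i + lattice_point \<tau> k)) (at 0)"
        if "i \<in> I" for i
        by (rule has_field_derivative_powr_minus_at_0[OF nz[OF that]])
    qed
    then show ?thesis by (simp add: DERIV_imp_deriv sum_negf)
  qed
  ultimately have "((\<lambda>k. - (\<Sum>i\<in>I. e i * Ln (b i + lattice_point \<tau> k))) has_sum
            (\<Sum>i\<in>I. e i * log_barnes_Gamma2 \<tau> (b i))) UNIV"
    by simp
  from has_sum_uminusI[OF this] show ?thesis by simp
qed

text \<open>
  The terms of the series of logarithms are dominated by the inverse cube of the size of \<open>k\<close>, uniformly
  for \<open>\<tau>\<close> near \<open>1\<close>, so the limit may be taken under the sum.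
\<close>

lemma tendsto_weighted_log_barnes_Gamma2:
  fixes e b :: "real \<Rightarrow> 'i \<Rightarrow> complex"
  assumes fin: "finite I"
    and e: "\<And>i. i \<in> I \<Longrightarrow> ((\<lambda>\<tau>. e \<tau> i) \<longlongrightarrow> e 1 i) (at_right 1)"
    and b: "\<And>i. i \<in> I \<Longrightarrow> ((\<lambda>\<tau>. b \<tau> i) \<longlongrightarrow> b 1 i) (at_right 1)"
    and pos: "\<And>i. i \<in> I \<Longrightarrow> 0 < Re (b 1 i)"
    and moments: "\<And>\<tau>. 1 \<le> \<tau> \<Longrightarrow> (\<Sum>i\<in>I. e \<tau> i) = 0" "\<And>\<tau>. 1 \<le> \<tau> \<Longrightarrow> (\<Sum>i\<in>I. e \<tau> i * b \<tau> i) = 0"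
      "\<And>\<tau>. 1 \<le> \<tau> \<Longrightarrow> (\<Sum>i\<in>I. e \<tau> i * (b \<tau> i)\<^sup>2) = 0"
  shows "((\<lambda>\<tau>. \<Sum>i\<in>I. e \<tau> i * log_barnes_Gamma2 \<tau> (b \<tau> i)) \<longlongrightarrow>
            (\<Sum>i\<in>I. e 1 i * log_barnes_Gamma2 1 (b 1 i))) (at_right 1)"
proof -
  obtain m where m: "0 < m" "m \<le> 1" "\<And>i. i \<in> I \<Longrightarrow> m \<le> Re (b 1 i) / 2"
    using finite_common_lower_bound[OF fin, of "\<lambda>i. Re (b 1 i) / 2"] pos by auto
  define T where "T = (\<lambda>k \<tau>. \<Sum>i\<in>I. e \<tau> i * Ln (b \<tau> i + lattice_point \<tau> k))"
  define Q where "Q = (\<lambda>\<tau>. \<Sum>i\<in>I. norm (e \<tau> i) * norm (b \<tau> i - 1) ^ 3)"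
  define S where "S = {\<tau>. 1 \<le> \<tau> \<and> (\<forall>i\<in>I. m \<le> Re (b \<tau> i)) \<and> Q \<tau> \<le> Q 1 + 1}"
  have ev1: "\<forall>\<^sub>F \<tau>::real in at_right 1. 1 \<le> \<tau>"
    by (auto simp: eventually_at_filter)
  have ev2: "\<forall>\<^sub>F \<tau> in at_right 1. \<forall>i\<in>I. m \<le> Re (b \<tau> i)"
  proof (rule eventually_ball_finite[OF fin], rule ballI)
    fix i assume i: "i \<in> I"
    have "m < Re (b 1 i)" using m(1) m(3)[OF i] by simp
    from order_tendstoD(1)[OF tendsto_Re[OF b[OF i]] this]
    show "\<forall>\<^sub>F \<tau> in at_right 1. m \<le> Re (b \<tau> i)" by eventually_elim simp
  qed
  have "(Q \<longlongrightarrow> Q 1) (at_right 1)"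
    unfolding Q_def by (intro tendsto_intros e b)
  from order_tendstoD(2)[OF this, of "Q 1 + 1"] have ev3: "\<forall>\<^sub>F \<tau> in at_right 1. Q \<tau> \<le> Q 1 + 1"
    by (auto elim: eventually_mono)
  have evS: "\<forall>\<^sub>F \<tau> in at_right 1. \<tau> \<in> S"
    using ev1 ev2 ev3 by eventually_elim (simp add: S_def)
  have hs: "((\<lambda>k. T k \<tau>) has_sum - (\<Sum>i\<in>I. e \<tau> i * log_barnes_Gamma2 \<tau> (b \<tau> i))) UNIV"
    if "1 \<le> \<tau>" "\<And>i. i \<in> I \<Longrightarrow> 0 < Re (b \<tau> i)" for \<tau>
    unfolding T_def using that by (intro weighted_log_barnes_Gamma2_has_sum fin moments)
  have bound: "norm (T k \<tau>) \<le> 2 / m ^ 3 * (Q 1 + 1) * (1 + real (fst k) + real (snd k)) powr (-3)"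
    if "\<tau> \<in> S" for k \<tau>
  proof -
    define v where "v = m * (1 + real (fst k) + real (snd k))"
    have tau: "1 \<le> \<tau>" using that by (simp add: S_def)
    have v: "0 < v" unfolding v_def using m(1) by (intro mult_pos_pos) auto
    have v_le: "v \<le> Re (w + lattice_point \<tau> k)" if "m \<le> Re w" for w
      unfolding v_def by (rule Re_add_lattice_point_ge[OF tau m(1,2) that])
    have "norm (T k \<tau>) \<le> 2 / v ^ 3 * Q \<tau>"
      using weighted_Ln_Taylor[of v "1 + lattice_point \<tau> k" I "\<lambda>i. b \<tau> i + lattice_point \<tau> k" "e \<tau>"]
        v moments(1)[OF tau] centred_moments_eq_0[OF moments[OF tau], of 1] v_le[of 1] v_le[of "b \<tau> _"] \<open>\<tau> \<in> S\<close> m(2)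
      by (simp add: T_def Q_def S_def)
    also have "\<dots> \<le> 2 / v ^ 3 * (Q 1 + 1)"
      using that v by (intro mult_left_mono) (auto simp: S_def)
    also have "\<dots> = 2 / m ^ 3 * (Q 1 + 1) * (1 + real (fst k) + real (snd k)) powr (-3)"
    proof -
      have "2 / (m * N) ^ 3 * (Q 1 + 1) = 2 / m ^ 3 * (Q 1 + 1) * N powr (-3)" if "0 < N" for N
        using m(1) that by (simp add: powr_minus power_mult_distrib field_simps)
      then show ?thesis unfolding v_def by (simp add: add_pos_nonneg)
    qed
    finally show ?thesis .
  qed
  have "uniform_limit S (\<lambda>K \<tau>. \<Sum>k\<in>K. T k \<tau>) (\<lambda>\<tau>. \<Sum>\<^sub>\<infinity>k. T k \<tau>) (finite_subsets_at_top UNIV)"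
  proof (rule Weierstrass_m_test_general)
    show "(\<lambda>k. 2 / m ^ 3 * (Q 1 + 1) * (1 + real (fst k) + real (snd k)) powr (-3)) summable_on UNIV"
      by (intro summable_on_cmult_right summable_on_lattice_powr) simp
  qed (rule bound)
  then have "((\<lambda>\<tau>. \<Sum>\<^sub>\<infinity>k. T k \<tau>) \<longlongrightarrow> - (\<Sum>i\<in>I. e 1 i * log_barnes_Gamma2 1 (b 1 i))) (at_right 1)"
  proof (rule swap_uniform_limit'[rotated 2])
    show "((\<lambda>K. \<Sum>k\<in>K. T k 1) \<longlongrightarrow> - (\<Sum>i\<in>I. e 1 i * log_barnes_Gamma2 1 (b 1 i))) (finite_subsets_at_top UNIV)"
      using hs[of 1] pos by (simp add: has_sum_def)
    show "\<forall>\<^sub>F K in finite_subsets_at_top UNIV. ((\<lambda>\<tau>. \<Sum>k\<in>K. T k \<tau>) \<longlongrightarrow> (\<Sum>k\<in>K. T k 1)) (at_right 1)"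
    proof (intro always_eventually allI tendsto_sum)
      fix k
      show "(T k \<longlongrightarrow> T k 1) (at_right 1)"
        unfolding T_def
      proof (intro tendsto_sum tendsto_mult e tendsto_Ln)
        fix i assume i: "i \<in> I"
        show "((\<lambda>\<tau>. b \<tau> i + lattice_point \<tau> k) \<longlongrightarrow> b 1 i + lattice_point 1 k) (at_right 1)"
          unfolding lattice_point_def by (intro tendsto_intros b[OF i])
        have "0 < Re (b 1 i + lattice_point 1 k)" using pos[OF i] by (simp add: lattice_point_def)
        then show "b 1 i + lattice_point 1 k \<notin> \<real>\<^sub>\<le>\<^sub>0" by (auto simp: complex_nonpos_Reals_iff)
      qed
    qed
  qed (use evS in auto)
  then have "((\<lambda>\<tau>. - (\<Sum>\<^sub>\<infinity>k. T k \<tau>)) \<longlongrightarrow> (\<Sum>i\<in>I. e 1 i * log_barnes_Gamma2 1 (b 1 i))) (at_right 1)"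
    using tendsto_minus by fastforce
  moreover have "\<forall>\<^sub>F \<tau> in at_right 1. - (\<Sum>\<^sub>\<infinity>k. T k \<tau>) = (\<Sum>i\<in>I. e \<tau> i * log_barnes_Gamma2 \<tau> (b \<tau> i))"
    using evS
  proof eventually_elim
    case (elim \<tau>)
    then have "((\<lambda>k. T k \<tau>) has_sum - (\<Sum>i\<in>I. e \<tau> i * log_barnes_Gamma2 \<tau> (b \<tau> i))) UNIV"
      using m(1) by (intro hs) (force simp: S_def)+
    then show ?case by (simp add: infsumI)
  qed
  ultimately show ?thesis by (rule Lim_transform_eventually)
qed

section \<open>The Barnes G-function\<close>

text \<open>
  The logarithm of the \<open>n\<close>-th factor of the canonical product, for \<open>Re w > 0\<close>. It is written with
  \<open>Ln (w + n) - Ln (n + 1)\<close> and not with the logarithm of the quotient, to match the series of the preceding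
  section.
\<close>

definition barnes_G_log_factor :: "complex \<Rightarrow> nat \<Rightarrow> complex" where
  "barnes_G_log_factor w n = of_nat (Suc n) * (Ln (w + of_nat n) - Ln (of_nat (Suc n)))
      + (w - 1)\<^sup>2 / (2 * of_nat (Suc n)) - (w - 1)"

definition log_barnes_G :: "complex \<Rightarrow> complex" where
  "log_barnes_G w = (w - 1) / 2 * of_real (ln (2 * pi)) - ((w - 1) + (w - 1)\<^sup>2 * (1 + euler_mascheroni)) / 2
      + (\<Sum>n. barnes_G_log_factor w n)"

text \<open>
  The exponential factors of the product cancel the linear and the quadratic Taylor term of the
  logarithm at \<open>n + 1\<close>. What is left is \<open>n + 1\<close> times a cubic remainder, so it decays like \<open>1 / (n + 1)\<^sup>2\<close>.
\<close>

lemma summable_barnes_G_log_factor: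
  assumes w: "0 < Re w"
  shows "summable (barnes_G_log_factor w)"
proof (rule summable_comparison_test')
  define m where "m = min 1 (Re w)"
  have m: "0 < m" "m \<le> 1" "m \<le> Re w" using w by (auto simp: m_def)
  show "summable (\<lambda>n. 2 / m ^ 3 * norm (w - 1) ^ 3 * inverse (real (Suc n) ^ 2))"
    by (intro summable_mult) (subst summable_Suc_iff, rule inverse_power_summable, simp)
  show "norm (barnes_G_log_factor w n) \<le> 2 / m ^ 3 * norm (w - 1) ^ 3 * inverse (real (Suc n) ^ 2)" for n
  proof -
    define a where "a = (of_nat (Suc n) :: complex)"
    have a0: "a \<noteq> 0" by (simp add: a_def del: of_nat_Suc)
    define X where "X = Ln (w + of_nat n) - (Ln a + (w - 1) / a - (w - 1)\<^sup>2 / (2 * a\<^sup>2))"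
    have mn: "m * real n \<le> real n" using m by (simp add: mult_left_le_one_le)
    have "0 < m + m * real n" using m by (simp add: add_pos_nonneg)
    then have "norm X \<le> 2 / (m * real (Suc n)) ^ 3 * norm (w - 1) ^ 3"
      using weighted_Ln_Taylor[of "m * real (Suc n)" a "{()}" "\<lambda>_. w + of_nat n" "\<lambda>_. 1"] m mn
      by (auto simp: a_def X_def algebra_simps)
    then have "real (Suc n) * norm X \<le> real (Suc n) * (2 / (m * real (Suc n)) ^ 3 * norm (w - 1) ^ 3)"
      by (intro mult_left_mono) auto
    also have "\<dots> = 2 / m ^ 3 * norm (w - 1) ^ 3 * inverse (real (Suc n) ^ 2)"
      using m(1) by (simp add: power_mult_distrib power2_eq_square power3_eq_cube divide_simps del: of_nat_Suc)
    finally have "norm (a * X) \<le> 2 / m ^ 3 * norm (w - 1) ^ 3 * inverse (real (Suc n) ^ 2)"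
      by (simp add: a_def norm_mult del: of_nat_Suc)
    moreover have "a * X = barnes_G_log_factor w n"
      using a0 unfolding X_def barnes_G_log_factor_def a_def[symmetric]
      by (simp add: field_simps power2_eq_square)
    ultimately show ?thesis by simp
  qed
qed

lemma barnes_G_eq_exp:
  assumes w: "0 < Re w"
  shows "barnes_G w = exp (log_barnes_G w)"
proof -
  have factor: "(1 + (w - 1) / of_nat (Suc n)) ^ Suc n * exp ((w - 1)\<^sup>2 / (2 * of_nat (Suc n)) - (w - 1))
     = exp (barnes_G_log_factor w n)" for n
  proof -
    have nz: "w + of_nat n \<noteq> 0" using w by (auto simp: complex_eq_iff)
    have nz': "(of_nat (Suc n) :: complex) \<noteq> 0" by (simp del: of_nat_Suc)
    have "exp (of_nat (Suc n) * (Ln (w + of_nat n) - Ln (of_nat (Suc n))))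
          = ((w + of_nat n) / of_nat (Suc n)) ^ Suc n"
      by (simp only: exp_of_nat_mult exp_diff exp_Ln[OF nz] exp_Ln[OF nz'])
    also have "(w + of_nat n) / of_nat (Suc n) = 1 + (w - 1) / of_nat (Suc n)"
      using nz' by (simp add: field_simps)
    finally show ?thesis
      unfolding barnes_G_log_factor_def add_diff_eq[symmetric] by (simp only: exp_add)
  qed
  have "(\<Prod>n. exp (barnes_G_log_factor w n)) = exp (\<Sum>n. barnes_G_log_factor w n)"
    by (rule prodinf_exp[OF summable_barnes_G_log_factor[OF w]])
  moreover have "of_real (2 * pi) powr ((w - 1) / 2) = exp ((w - 1) / 2 * of_real (ln (2 * pi)))"
    by (simp add: powr_def Ln_of_real[of "2 * pi", simplified])
  moreover have "exp (x - y / 2 + z) = exp x * exp (- y / 2) * exp z" for x y z :: complex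
  proof -
    have "x - y / 2 + z = x + (- y / 2) + z" by simp
    then show ?thesis by (simp only: exp_add)
  qed
  ultimately show ?thesis
    unfolding barnes_G_def Let_def factor log_barnes_G_def by (simp only:)
qed

text \<open>
  For \<open>\<tau> = 1\<close> a term of the double series depends only on \<open>k1 + k2\<close>, and \<open>n\<close> arises as such a sum in \<open>n + 1\<close> ways.
  This is the origin of the exponents \<open>n + 1\<close> in the product for the Barnes G-function.
\<close>

lemma has_sum_antidiagonals:
  fixes f :: "nat \<Rightarrow> complex"
  assumes "((\<lambda>k. f (fst k + snd k)) has_sum S) UNIV"
  shows "(\<lambda>n. of_nat (Suc n) * f n) sums S"
proof -
  have "((\<lambda>k. f (fst k + snd k)) has_sum S) UNIV \<longleftrightarrow> ((\<lambda>k. f (fst k)) has_sum S) (SIGMA n:UNIV. {..n})"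
    by (rule has_sum_reindex_bij_witness[where j = "\<lambda>k. (fst k + snd k, snd k)" and i = "\<lambda>k. (fst k - snd k, snd k)"])
       auto
  with assms have "((\<lambda>k. f (fst k)) has_sum S) (SIGMA n:UNIV. {..n})" by blast
  then have "((\<lambda>n. of_nat (Suc n) * f n) has_sum S) UNIV"
  proof (rule has_sum_SigmaD)
    show "((\<lambda>j. f (fst (n, j))) has_sum of_nat (Suc n) * f n) {..n}" for n
      by (rule has_sum_finiteI) auto
  qed
  then show ?thesis by (rule has_sum_imp_sums)
qed

text \<open>
  The sum of \<open>log_barnes_Gamma2 1\<close> and \<open>log_barnes_G\<close> is a polynomial of degree at most two. Weights with
  three vanishing moments annihilate such polynomials, so neither that polynomial nor the convergence
  factors of the product have to be computed.
\<close>

lemma weighted_log_barnes_Gamma2_eq_log_barnes_G: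
  fixes e b :: "'i \<Rightarrow> complex"
  assumes fin: "finite I" and pos: "\<And>i. i \<in> I \<Longrightarrow> 0 < Re (b i)"
    and moments: "(\<Sum>i\<in>I. e i) = 0" "(\<Sum>i\<in>I. e i * b i) = 0" "(\<Sum>i\<in>I. e i * (b i)\<^sup>2) = 0"
  shows "(\<Sum>i\<in>I. e i * log_barnes_Gamma2 1 (b i)) = - (\<Sum>i\<in>I. e i * log_barnes_G (b i))"
proof -
  note centred = centred_moments_eq_0[OF moments, of 1]
  have lin: "(\<Sum>i\<in>I. e i * (A i + c * (b i - 1) + d * (b i - 1)\<^sup>2 + x)) = (\<Sum>i\<in>I. e i * A i)" for A c d x
  proof -
    have "(\<Sum>i\<in>I. e i * (A i + c * (b i - 1) + d * (b i - 1)\<^sup>2 + x)) =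
      (\<Sum>i\<in>I. e i * A i) + c * (\<Sum>i\<in>I. e i * (b i - 1)) + d * (\<Sum>i\<in>I. e i * (b i - 1)\<^sup>2) + x * (\<Sum>i\<in>I. e i)"
      unfolding sum_distrib_left sum.distrib[symmetric] by (intro sum.cong refl) (simp add: algebra_simps)
    then show ?thesis using moments(1) centred by simp
  qed
  have "((\<lambda>k. \<Sum>i\<in>I. e i * Ln (b i + of_nat (fst k + snd k))) has_sum
            - (\<Sum>i\<in>I. e i * log_barnes_Gamma2 1 (b i))) UNIV"
    using weighted_log_barnes_Gamma2_has_sum[OF fin order.refl pos moments] by (simp add: lattice_point_def)
  from has_sum_antidiagonals[OF this]
  have "(\<lambda>n. of_nat (Suc n) * (\<Sum>i\<in>I. e i * Ln (b i + of_nat n))) sums - (\<Sum>i\<in>I. e i * log_barnes_Gamma2 1 (b i))" .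
  moreover have "of_nat (Suc n) * (\<Sum>i\<in>I. e i * Ln (b i + of_nat n)) = (\<Sum>i\<in>I. e i * barnes_G_log_factor (b i) n)" for n
    using lin[of "\<lambda>i. of_nat (Suc n) * Ln (b i + of_nat n)" "-1" "1 / (2 * of_nat (Suc n))" "- of_nat (Suc n) * Ln (of_nat (Suc n))"]
    unfolding barnes_G_log_factor_def sum_distrib_left
    by (simp add: algebra_simps)
  moreover have "(\<lambda>n. \<Sum>i\<in>I. e i * barnes_G_log_factor (b i) n) sums (\<Sum>i\<in>I. e i * (\<Sum>n. barnes_G_log_factor (b i) n))"
    by (intro sums_sum sums_mult summable_sums summable_barnes_G_log_factor pos)
  ultimately have "(\<Sum>i\<in>I. e i * (\<Sum>n. barnes_G_log_factor (b i) n)) = - (\<Sum>i\<in>I. e i * log_barnes_Gamma2 1 (b i))"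
    by (simp add: sums_unique2)
  moreover have "(\<Sum>i\<in>I. e i * log_barnes_G (b i)) = (\<Sum>i\<in>I. e i * (\<Sum>n. barnes_G_log_factor (b i) n))"
    using lin[of "\<lambda>i. (\<Sum>n. barnes_G_log_factor (b i) n)" "of_real (ln (2 * pi)) / 2 - 1 / 2" "- (1 + euler_mascheroni) / 2" 0]
    unfolding log_barnes_G_def by (simp add: field_simps)
  ultimately show ?thesis by simp
qed

lemma log_barnes_G_1: "log_barnes_G 1 = 0"
  by (simp add: log_barnes_G_def barnes_G_log_factor_def add.commute)

text \<open>
  This is the case \<open>w = 1\<close> of \<open>G(w) G(w + 2) = w G(w + 1)\<^sup>2\<close>, in logarithmic form. Partial summation of the
  second differences of \<open>ln\<close> leads to the limit of \<open>harm N - ln N\<close>, and the Euler--Mascheroni constant in the quadratic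
  exponent of the product is exactly what compensates it.
\<close>

lemma log_barnes_G_3: "log_barnes_G 3 = 2 * log_barnes_G 2"
proof -
  define \<delta> where "\<delta> = (\<lambda>n. barnes_G_log_factor 3 n - 2 * barnes_G_log_factor 2 n)"
  define l where "l = (\<lambda>n. ln (real (Suc n)))"
  have Ln_l: "Ln (of_nat (Suc n)) = of_real (l n)" for n
    unfolding l_def by (metis Ln_of_real of_nat_0_less_iff of_real_of_nat_eq zero_less_Suc)
  have \<delta>: "\<delta> n = of_real (real (Suc n) * (l (n + 2) - 2 * l (n + 1) + l n) + inverse (real (Suc n)))" for n
  proof -
    have "3 + of_nat n = (of_nat (Suc (n + 2)) :: complex)" "2 + of_nat n = (of_nat (Suc (n + 1)) :: complex)"
      by simp_all
    then have "Ln (3 + of_nat n) = of_real (l (n + 2))" "Ln (2 + of_nat n) = of_real (l (n + 1))"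
      by (simp_all only: Ln_l)
    moreover have "(of_nat (Suc n) :: complex) \<noteq> 0" by (simp del: of_nat_Suc)
    ultimately show ?thesis
      unfolding \<delta>_def barnes_G_log_factor_def Ln_l
      by (simp add: field_simps power2_eq_square del: of_nat_Suc)
  qed
  have partial: "(\<Sum>n<N. real (Suc n) * (l (n + 2) - 2 * l (n + 1) + l n) + inverse (real (Suc n)))
      = real N * (l (N + 1) - l N) - l N + harm N" for N
    by (induction N) (simp_all add: harm_def l_def algebra_simps)
  have "(\<lambda>N. real N * (l (N + 1) - l N) - (l N - ln (real N)) + (harm N - ln (real N))) \<longlonglongrightarrow> 1 - 0 + euler_mascheroni"
    unfolding l_def by (intro tendsto_intros euler_mascheroni_LIMSEQ) real_asymp+
  then have "(\<lambda>n. real (Suc n) * (l (n + 2) - 2 * l (n + 1) + l n) + inverse (real (Suc n))) sums (1 + euler_mascheroni)"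
    unfolding sums_def partial by (simp add: algebra_simps)
  then have "\<delta> sums of_real (1 + euler_mascheroni)"
    unfolding \<delta>[abs_def] by (rule sums_of_real)
  moreover have "\<delta> sums ((\<Sum>n. barnes_G_log_factor 3 n) - 2 * (\<Sum>n. barnes_G_log_factor 2 n))"
    unfolding \<delta>_def by (intro sums_diff sums_mult summable_sums summable_barnes_G_log_factor) auto
  ultimately have "(\<Sum>n. barnes_G_log_factor 3 n) - 2 * (\<Sum>n. barnes_G_log_factor 2 n) = 1 + euler_mascheroni"
    using sums_unique2 by fastforce
  then have eq: "(\<Sum>n. barnes_G_log_factor 3 n) = 2 * (\<Sum>n. barnes_G_log_factor 2 n) + (1 + euler_mascheroni)"
    by (simp add: algebra_simps)
  show ?thesis unfolding log_barnes_G_def eq by (simp add: field_simps)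
qed

section \<open>The limit of the ratio of double gamma functions\<close>

text \<open>
  The arguments of the sixteen double gamma factors, each numerator followed by its denominator, and
  then the vertices \<open>1\<close>, \<open>2\<close>, \<open>1 + t\<close>, \<open>2 + t\<close> of a cell. With the weights \<open>1\<close> and \<open>-1\<close> for numerators and
  denominators, the moments of order \<open>0\<close> and \<open>1\<close> of the sixteen arguments vanish, and the second moment is
  \<open>2 * q * (1 + t)\<close>. The mixed difference over a cell has moments \<open>0\<close>, \<open>0\<close> and \<open>2 * t\<close>; so subtracting
  \<open>q * (1 + t) / t\<close> times this difference makes the second moment vanish too. The cell at \<open>1\<close> is chosen because
  the mixed difference of \<open>log_barnes_Gamma2\<close> there is \<open>- Ln 1 = 0\<close>.
\<close>

definition selberg_points :: "complex \<Rightarrow> complex \<Rightarrow> complex \<Rightarrow> complex \<Rightarrow> complex list" where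
  "selberg_points q a b t =
     [1 - q + t * (1 + a), 1 + t * (1 + a), 1 - q + t * (1 + b), 1 + t * (1 + b),
      1 - q + t, 1 + t, 2 - q + t * (2 + a + b), 2 - 2 * q + t * (2 + a + b),
      q + 1 + t, 1 + t, q - t * a, - t * a, q - t * b, - t * b,
      q - 1 - t * (1 + a + b), 2 * q - 1 - t * (1 + a + b),
      1, 2, 1 + t, 2 + t]"

definition selberg_weights :: "complex \<Rightarrow> complex \<Rightarrow> complex list" where
  "selberg_weights q t = (let c = q * (1 + t) / t in
     [1, -1, 1, -1, 1, -1, 1, -1, 1, -1, 1, -1, 1, -1, 1, -1, - c, c, c, - c])"

lemma sum_lessThan_20:
  fixes f :: "nat \<Rightarrow> complex"
  shows "(\<Sum>i<20. f i) = f 0 + f 1 + f 2 + f 3 + f 4 + f 5 + f 6 + f 7 + f 8 + f 9 + f 10 + f 11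
           + f 12 + f 13 + f 14 + f 15 + f 16 + f 17 + f 18 + f 19"
  by (simp add: eval_nat_numeral)

lemma sum_selberg:
  "(\<Sum>i<20. selberg_weights q t ! i * f (selberg_points q a b t ! i)) =
     f (1 - q + t * (1 + a)) - f (1 + t * (1 + a)) + (f (1 - q + t * (1 + b)) - f (1 + t * (1 + b)))
     + (f (1 - q + t) - f (1 + t)) + (f (2 - q + t * (2 + a + b)) - f (2 - 2 * q + t * (2 + a + b)))
     + (f (q + 1 + t) - f (1 + t)) + (f (q - t * a) - f (- t * a)) + (f (q - t * b) - f (- t * b))
     + (f (q - 1 - t * (1 + a + b)) - f (2 * q - 1 - t * (1 + a + b)))
     - q * (1 + t) / t * (f 1 - f 2 - f (1 + t) + f (2 + t))"
  unfolding sum_lessThan_20 by (simp add: selberg_points_def selberg_weights_def Let_def algebra_simps)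

lemma selberg_moments:
  assumes "t \<noteq> 0"
  shows "(\<Sum>i<20. selberg_weights q t ! i) = 0"
    and "(\<Sum>i<20. selberg_weights q t ! i * selberg_points q a b t ! i) = 0"
    and "(\<Sum>i<20. selberg_weights q t ! i * (selberg_points q a b t ! i)\<^sup>2) = 0"
proof -
  show "(\<Sum>i<20. selberg_weights q t ! i) = 0"
    using sum_selberg[of q t "\<lambda>_. 1" a b] by simp
  show "(\<Sum>i<20. selberg_weights q t ! i * selberg_points q a b t ! i) = 0"
    unfolding sum_selberg[of q t "\<lambda>x. x" a b] by (simp add: algebra_simps)
  have "q * (1 + t) / t * (1\<^sup>2 - 2\<^sup>2 - (1 + t)\<^sup>2 + (2 + t)\<^sup>2) = 2 * q * (1 + t)"
    using assms by (simp add: power2_eq_square field_simps)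
  then show "(\<Sum>i<20. selberg_weights q t ! i * (selberg_points q a b t ! i)\<^sup>2) = 0"
    unfolding sum_selberg[of q t "\<lambda>x. x\<^sup>2" a b] by (simp add: power2_eq_square algebra_simps)
qed

text \<open>
  The product of the eight quotients, with a general function \<open>F\<close> so that the double gamma function and the
  Barnes G-function can be treated alike.
\<close>

definition selberg_ratio :: "(complex \<Rightarrow> complex) \<Rightarrow> complex \<Rightarrow> complex \<Rightarrow> complex \<Rightarrow> complex \<Rightarrow> complex" where
  "selberg_ratio F q a b t =
     F (1 - q + t * (1 + a)) / F (1 + t * (1 + a)) * (F (1 - q + t * (1 + b)) / F (1 + t * (1 + b)))
     * (F (1 - q + t) / F (1 + t)) * (F (2 - q + t * (2 + a + b)) / F (2 - 2 * q + t * (2 + a + b)))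
     * (F (q + 1 + t) / F (1 + t)) * (F (q - t * a) / F (- t * a)) * (F (q - t * b) / F (- t * b))
     * (F (q - 1 - t * (1 + a + b)) / F (2 * q - 1 - t * (1 + a + b)))"

text \<open>
  The auxiliary points drop out: their contribution is a multiple of a mixed difference that is zero.
\<close>

lemma selberg_ratio_eq_exp:
  assumes F: "\<And>i. i < 20 \<Longrightarrow> F (selberg_points q a b t ! i) = exp (f (selberg_points q a b t ! i))"
    and f: "f 1 - f 2 - f (1 + t) + f (2 + t) = 0"
  shows "selberg_ratio F q a b t = exp (\<Sum>i<20. selberg_weights q t ! i * f (selberg_points q a b t ! i))"
proof -
  have "\<forall>x\<in>set (selberg_points q a b t). F x = exp (f x)"
    using F unfolding Ball_def in_set_conv_nth by (auto simp: selberg_points_def)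
  note F_eq = this[unfolded selberg_points_def list.set ball_simps]
  show ?thesis
    unfolding sum_selberg f selberg_ratio_def
    by (simp only: F_eq exp_add exp_diff mult_zero_right diff_0_right)
qed

lemma less_20_iff:
  fixes i :: nat
  shows "i < 20 \<longleftrightarrow> i \<in> {0, 1, 2, 3, 4, 5, 6, 7, 8, 9, 10, 11, 12, 13, 14, 15, 16, 17, 18, 19}"
  by (auto simp: numeral_eq_Suc less_Suc_eq)

lemma Re_selberg_points_pos:
  fixes l\<^sub>1 l\<^sub>2 :: real and q :: complex
  assumes "- 2 < l\<^sub>1" "l\<^sub>1 < 0" "- 2 < l\<^sub>2" "l\<^sub>2 < 0"
    and "max ((2 + l\<^sub>1 + l\<^sub>2) / 2) (2 + l\<^sub>1 + l\<^sub>2) < Re q" "Re q < Min {1, 2 + l\<^sub>1, 2 + l\<^sub>2}" "i < 20"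
  shows "0 < Re (selberg_points q (of_real l\<^sub>1) (of_real l\<^sub>2) 1 ! i)"
proof -
  have "\<forall>x\<in>set (selberg_points q (of_real l\<^sub>1) (of_real l\<^sub>2) 1). 0 < Re x"
    using assms by (simp add: selberg_points_def)
  moreover have "length (selberg_points q (of_real l\<^sub>1) (of_real l\<^sub>2) 1) = 20"
    by (simp add: selberg_points_def)
  ultimately show ?thesis using \<open>i < 20\<close> by (metis nth_mem)
qed

text \<open>
  Both sides are exponentials of weighted sums with three vanishing moments. The sum for the double gamma
  function is continuous at \<open>\<tau> = 1\<close>, where it is minus the sum for the Barnes G-function.
\<close>

lemma tendsto_selberg_ratio_barnes_Gamma2:
  assumes pos: "\<And>i. i < 20 \<Longrightarrow> 0 < Re (selberg_points q a b 1 ! i)"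
  shows "((\<lambda>\<tau>. selberg_ratio (\<lambda>w. barnes_Gamma2 w \<tau>) q a b (of_real \<tau>)) \<longlongrightarrow>
            inverse (selberg_ratio barnes_G q a b 1)) (at_right 1)"
proof -
  define L where "L = (\<lambda>\<tau>. \<Sum>i<20. selberg_weights q (of_real \<tau>) ! i
      * log_barnes_Gamma2 \<tau> (selberg_points q a b (of_real \<tau>) ! i))"
  have of_real_lim: "((\<lambda>\<tau>::real. of_real \<tau> :: complex) \<longlongrightarrow> 1) (at_right 1)"
    using tendsto_of_real[OF tendsto_ident_at, of 1 "{1<..}"] by simp
  have pts: "((\<lambda>\<tau>. selberg_points q a b (of_real \<tau>) ! i) \<longlongrightarrow> selberg_points q a b 1 ! i) (at_right 1)"
    if "i < 20" for i
    using that unfolding selberg_points_def less_20_iff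
    by (auto intro!: tendsto_eq_intros of_real_lim)
  have wts: "((\<lambda>\<tau>. selberg_weights q (of_real \<tau>) ! i) \<longlongrightarrow> selberg_weights q 1 ! i) (at_right 1)"
    if "i < 20" for i
    using that unfolding selberg_weights_def less_20_iff Let_def
    by (auto intro!: tendsto_eq_intros of_real_lim)
  have lim: "(L \<longlongrightarrow> L 1) (at_right 1)"
    unfolding L_def using pts wts pos selberg_moments
    by (intro tendsto_weighted_log_barnes_Gamma2) auto
  have "L 1 = - (\<Sum>i<20. selberg_weights q 1 ! i * log_barnes_G (selberg_points q a b 1 ! i))"
    unfolding L_def of_real_1 using pos selberg_moments[of 1]
    by (intro weighted_log_barnes_Gamma2_eq_log_barnes_G) auto
  moreover have "selberg_ratio barnes_G q a b 1 =
      exp (\<Sum>i<20. selberg_weights q 1 ! i * log_barnes_G (selberg_points q a b 1 ! i))"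
    by (intro selberg_ratio_eq_exp barnes_G_eq_exp pos) (simp_all add: log_barnes_G_1 log_barnes_G_3)
  ultimately have "exp (L 1) = inverse (selberg_ratio barnes_G q a b 1)"
    by (simp add: exp_minus)
  with tendsto_exp[OF lim]
  have "((\<lambda>\<tau>. exp (L \<tau>)) \<longlongrightarrow> inverse (selberg_ratio barnes_G q a b 1)) (at_right 1)" by simp
  moreover have "\<forall>\<^sub>F \<tau> in at_right 1. exp (L \<tau>) = selberg_ratio (\<lambda>w. barnes_Gamma2 w \<tau>) q a b (of_real \<tau>)"
  proof -
    have "\<forall>\<^sub>F \<tau> in at_right 1. \<forall>i\<in>{..<20}. 0 < Re (selberg_points q a b (of_real \<tau>) ! i)"
      using order_tendstoD(1)[OF tendsto_Re[OF pts] pos] by (intro eventually_ball_finite) auto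
    moreover have "\<forall>\<^sub>F \<tau>::real in at_right 1. 1 \<le> \<tau>" by (auto simp: eventually_at_filter)
    ultimately show ?thesis
    proof eventually_elim
      case (elim \<tau>)
      have "log_barnes_Gamma2 \<tau> 1 - log_barnes_Gamma2 \<tau> 2 - log_barnes_Gamma2 \<tau> (1 + of_real \<tau>)
              + log_barnes_Gamma2 \<tau> (2 + of_real \<tau>) = 0"
        using log_barnes_Gamma2_mixed_difference[of \<tau> 1] elim by simp
      then show ?case
        unfolding L_def using elim
        by (intro selberg_ratio_eq_exp[symmetric] barnes_Gamma2_eq_exp) auto
    qed
  qed
  ultimately show ?thesis by (rule Lim_transform_eventually)
qed

text \<open>
  The divergent factors \<open>\<Gamma>(1 - 1/\<tau>)\<close> cancel, as the bases are positive for \<open>\<tau> > 1\<close>.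
\<close>

lemma tendsto_CM_prefactor:
  fixes q :: complex
  shows "((\<lambda>\<tau>::real. of_real (Gamma (1 - 1 / \<tau>)) powr q
      * of_real (Gamma (1 / \<tau>) * pi * \<tau> powr (1 / \<tau>) / Gamma (1 - 1 / \<tau>)) powr q)
     \<longlongrightarrow> of_real pi powr q) (at_right 1)"
proof (rule Lim_transform_eventually)
  have "((\<lambda>\<tau>::real. Gamma (1 / \<tau>) * pi * \<tau> powr (1 / \<tau>)) \<longlongrightarrow> Gamma (1 / 1) * pi * 1 powr (1 / 1)) (at_right 1)"
    by (intro tendsto_intros) auto
  then have "((\<lambda>\<tau>::real. complex_of_real (Gamma (1 / \<tau>) * pi * \<tau> powr (1 / \<tau>))) \<longlongrightarrow> of_real pi) (at_right 1)"
    using tendsto_of_real by fastforce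
  then show "((\<lambda>\<tau>::real. of_real (Gamma (1 / \<tau>) * pi * \<tau> powr (1 / \<tau>)) powr q) \<longlongrightarrow> of_real pi powr q) (at_right 1)"
    using pi_gt_zero by (intro tendsto_powr_complex tendsto_const) (auto simp: complex_nonpos_Reals_iff not_le)
  have "\<forall>\<^sub>F \<tau>::real in at_right 1. 1 < \<tau>" by (auto simp: eventually_at_filter)
  then show "\<forall>\<^sub>F \<tau>::real in at_right 1. of_real (Gamma (1 / \<tau>) * pi * \<tau> powr (1 / \<tau>)) powr q =
      of_real (Gamma (1 - 1 / \<tau>)) powr q
      * of_real (Gamma (1 / \<tau>) * pi * \<tau> powr (1 / \<tau>) / Gamma (1 - 1 / \<tau>)) powr q"
  proof eventually_elim
    case (elim \<tau>)
    define A where "A = Gamma (1 - 1 / \<tau>)"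
    define B where "B = Gamma (1 / \<tau>) * pi * \<tau> powr (1 / \<tau>) / A"
    have A: "0 < A" unfolding A_def using elim by (intro Gamma_real_pos) simp
    have B: "0 < B" unfolding B_def using elim A by (intro divide_pos_pos mult_pos_pos Gamma_real_pos) auto
    have "complex_of_real (A * B) powr q = of_real A powr q * of_real B powr q"
      using A B by (simp add: powr_times_real)
    moreover have "A * B = Gamma (1 / \<tau>) * pi * \<tau> powr (1 / \<tau>)"
      using A by (simp add: B_def)
    ultimately show ?case by (simp only: A_def B_def)
  qed
qed

theorem corollary11p2:
  fixes l\<^sub>1 l\<^sub>2 :: real and q :: complex
  assumes "- 2 < l\<^sub>1" "l\<^sub>1 < 0" "- 2 < l\<^sub>2" "l\<^sub>2 < 0"
    and "l\<^sub>1 + l\<^sub>2 < - 1"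
    and "max ((2 + l\<^sub>1 + l\<^sub>2) / 2) (2 + l\<^sub>1 + l\<^sub>2) < Re q"
    and "Re q < Min {1, 2 + l\<^sub>1, 2 + l\<^sub>2}"
  shows "((\<lambda>\<tau>::real. complex_of_real (Gamma (1 - 1 / \<tau>)) powr q * CM q \<tau> l\<^sub>1 l\<^sub>2) \<longlongrightarrow>
      complex_of_real pi powr q * Gamma (1 - q)
      * (barnes_G (2 + of_real l\<^sub>1) / barnes_G (2 - q + of_real l\<^sub>1))
      * (barnes_G (2 + of_real l\<^sub>2) / barnes_G (2 - q + of_real l\<^sub>2))
      * (barnes_G 2 / barnes_G (2 - q))
      * (barnes_G (4 - 2 * q + of_real l\<^sub>1 + of_real l\<^sub>2) / barnes_G (4 - q + of_real l\<^sub>1 + of_real l\<^sub>2))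
      * (barnes_G 2 / barnes_G (q + 2))
      * (barnes_G (- of_real l\<^sub>1) / barnes_G (q - of_real l\<^sub>1))
      * (barnes_G (- of_real l\<^sub>2) / barnes_G (q - of_real l\<^sub>2))
      * (barnes_G (2 * q - 2 - (of_real l\<^sub>1 + of_real l\<^sub>2)) / barnes_G (q - 2 - (of_real l\<^sub>1 + of_real l\<^sub>2))))
    (at_right 1)"
proof -
  define a b where "a = complex_of_real l\<^sub>1" and "b = complex_of_real l\<^sub>2"
  have pos: "0 < Re (selberg_points q a b 1 ! i)" if "i < 20" for i
    unfolding a_def b_def using assms that by (intro Re_selberg_points_pos)
  have "((\<lambda>\<tau>::real. Gamma (1 - q / of_real \<tau>)) \<longlongrightarrow> Gamma (1 - q / of_real 1)) (at_right 1)"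
    using assms(7)
    by (intro tendsto_intros) (auto elim!: nonpos_Ints_cases simp: complex_eq_iff)
  then have Gamma: "((\<lambda>\<tau>::real. Gamma (1 - q / of_real \<tau>)) \<longlongrightarrow> Gamma (1 - q)) (at_right 1)"
    by simp
  have "((\<lambda>\<tau>::real. of_real (Gamma (1 - 1 / \<tau>)) powr q
      * of_real (Gamma (1 / \<tau>) * pi * \<tau> powr (1 / \<tau>) / Gamma (1 - 1 / \<tau>)) powr q
      * Gamma (1 - q / of_real \<tau>) * selberg_ratio (\<lambda>w. barnes_Gamma2 w \<tau>) q a b (of_real \<tau>))
      \<longlongrightarrow> of_real pi powr q * Gamma (1 - q) * inverse (selberg_ratio barnes_G q a b 1)) (at_right 1)"
    by (intro tendsto_mult tendsto_CM_prefactor Gamma tendsto_selberg_ratio_barnes_Gamma2 pos)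
  moreover have "of_real (Gamma (1 - 1 / \<tau>)) powr q
      * of_real (Gamma (1 / \<tau>) * pi * \<tau> powr (1 / \<tau>) / Gamma (1 - 1 / \<tau>)) powr q
      * Gamma (1 - q / of_real \<tau>) * selberg_ratio (\<lambda>w. barnes_Gamma2 w \<tau>) q a b (of_real \<tau>)
      = complex_of_real (Gamma (1 - 1 / \<tau>)) powr q * CM q \<tau> l\<^sub>1 l\<^sub>2" for \<tau>
    by (simp only: CM_def Let_def selberg_ratio_def a_def b_def mult.assoc)
  moreover have "inverse (selberg_ratio barnes_G q a b 1) =
      barnes_G (2 + a) / barnes_G (2 - q + a) * (barnes_G (2 + b) / barnes_G (2 - q + b))
      * (barnes_G 2 / barnes_G (2 - q)) * (barnes_G (4 - 2 * q + a + b) / barnes_G (4 - q + a + b))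
      * (barnes_G 2 / barnes_G (q + 2)) * (barnes_G (- a) / barnes_G (q - a)) * (barnes_G (- b) / barnes_G (q - b))
      * (barnes_G (2 * q - 2 - (a + b)) / barnes_G (q - 2 - (a + b)))"
  proof -
    have args: "1 - q + 1 * (1 + a) = 2 - q + a" "1 + 1 * (1 + a) = 2 + a"
      "1 - q + 1 * (1 + b) = 2 - q + b" "1 + 1 * (1 + b) = 2 + b" "1 - q + 1 = 2 - q" "1 + 1 = (2 :: complex)"
      "2 - q + 1 * (2 + a + b) = 4 - q + a + b" "2 - 2 * q + 1 * (2 + a + b) = 4 - 2 * q + a + b"
      "q + 1 + 1 = q + 2" "q - 1 * a = q - a" "- 1 * a = - a" "q - 1 * b = q - b" "- 1 * b = - b"
      "q - 1 - 1 * (1 + a + b) = q - 2 - (a + b)" "2 * q - 1 - 1 * (1 + a + b) = 2 * q - 2 - (a + b)"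
      by simp_all
    show ?thesis
      unfolding selberg_ratio_def args by (simp only: inverse_mult_distrib inverse_divide)
  qed
  ultimately show ?thesis
    by (simp only: a_def b_def mult.assoc)
qed

end
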